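(* Let $(\psi,\phi):(\Lambda,w,\mathscr{H},\varepsilon)\to(\Lambda',w',\mathscr{H}',\varepsilon')$ be an isomorphism of input data over $k$, and let $\mathfrak{h}$ and $\mathfrak{h}'$ be the Lie algebras constructed from these two input data. Write $\phi$ also for the induced isomorphism $\widetilde\Lambda\to\widetilde\Lambda'$, $(\lambda,h)\mapsto(\psi(\lambda),\phi(h))$. Define $\widetilde\phi:\mathfrak{h}\to\mathfrak{h}'$ by setting $\widetilde\phi(\alpha^\vee)=\psi(\alpha)^\vee$ for $\alpha\in\Phi$ and $\widetilde\phi(X_{\tilde\alpha})=X'_{\phi(\tilde\alpha)}$ for $\tilde\alpha\in\widetilde\Phi$, and extending linearly. Then $\widetilde\phi$ is a well-defined isomorphism of Lie algebras.
   Context: A lattice is a finitely generated free $\mathbb{Z}$-module $\Lambda$ with a symmetric positive-definite bilinear form $(\cdot,\cdot):\Lambda\times\Lambda\to\mathbb{Z}$; isomorphisms of lattices are $\mathbb{Z}$-linear bijections preserving the forms. $\Lambda$ is a simply laced root lattice if it is generated by its set of roots $\Phi=\{\alpha\in\Lambda : (\alpha,\alpha)=2\}$. For $\gamma\in\Lambda$, $\gamma^\vee\in\operatorname{Hom}(\Lambda,\mathbb{Z})$ is $\gamma^\vee(\alpha)=(\gamma,\alpha)$. An automorphism $w\in\operatorname{Aut}(\Lambda)$ is elliptic if the group of coinvariants $\Lambda_w=\Lambda/(1-w)\Lambda$ is finite. Setting: $\Lambda$ is a simply laced root lattice, $w$ an elliptic automorphism of $\Lambda$ of order $d$, $k$ a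 field of characteristic zero containing a primitive $d$th root of unity $\zeta$, and $1\to\langle\zeta\rangle\to\mathscr{H}\to\Lambda_w\to1$ a central extension with commutator pairing $\langle\cdot,\cdot\rangle:\Lambda_w\times\Lambda_w\to\langle\zeta\rangle$. Let $\widetilde\Lambda=\Lambda\times_{\Lambda_w}\mathscr{H}$, a central extension of $\Lambda$ by $\langle\zeta\rangle$; its commutator pairing on $\Lambda$ (the pullback of that on $\Lambda_w$) is also written $\langle\cdot,\cdot\rangle$. Let $\widetilde\Phi$ be the preimage of $\Phi$ in $\widetilde\Lambda$; for $\tilde\alpha\in\widetilde\Phi$ write $\alpha$ for its image in $\Phi$. The quadruple $(\Lambda,w,\mathscr{H},\varepsilon)$ is an input datum if $\varepsilon:\Lambda\times\Lambda\to k^\times$ is bilinear (multiplicative in each variable) and: (1) $\varepsilon(\alpha,\beta)/\varepsilon(\beta,\alpha)=-\langle\beta,\alpha\rangle$ whenever $(\alpha,\beta)=-1$; (2) $\varepsilon(w\alpha,w\beta)=\varepsilon(\alpha,\beta)$ for all $\alpha,\beta\in\Lambda$. Construction of $\mathfrak{h}$: $\mathfrak{t}=\operatorname{Hom}(\Lambda,k)$, spanned by $\{\alpha^\vee:\alpha\in\Phi\}$; $\mathfrak{l}$ is the $k$-vector space generated by symbols $X_{\tilde\alpha}$, $\tilde\alpha\in\widetilde\Phi$, modulo the relations $X_{\zeta\tilde\alpha}=\zeta X_{\tilde\alpha}$; $\mathfrak{h}=\mathfrak{t}\oplus\mathfrak{l}$. It is a Lie algebra under the $k$-bilinear bracket with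 $[\mathfrak{t},\mathfrak{t}]=0$, $[\alpha^\vee,X_{\tilde\beta}]=-[X_{\tilde\beta},\alpha^\vee]=(\alpha,\beta)X_{\tilde\beta}$, and $[X_{\tilde\alpha},X_{\tilde\beta}]=\varepsilon(\alpha,\beta)\,\tilde\alpha\tilde\beta\,\alpha^\vee$ if $\alpha+\beta=0$ (with $\tilde\alpha\tilde\beta\in\langle\zeta\rangle\subset k^\times$ a scalar), $\varepsilon(\alpha,\beta)X_{\tilde\alpha\tilde\beta}$ if $\alpha+\beta\in\Phi$, and $0$ otherwise. An isomorphism of input data $(\Lambda,w,\mathscr{H},\varepsilon)\to(\Lambda',w',\mathscr{H}',\varepsilon')$ (same $k$ and $\zeta$) is a pair $(\psi,\phi)$ where $\psi:\Lambda\to\Lambda'$ is an isomorphism of lattices with $\psi w=w'\psi$ and $\varepsilon'(\psi(\alpha),\psi(\beta))=\varepsilon(\alpha,\beta)$ for all $\alpha,\beta\in\Lambda$, and $\phi:\mathscr{H}\to\mathscr{H}'$ is a group isomorphism that is the identity on $\langle\zeta\rangle$ and induces on the quotients the map $\overline\psi:\Lambda_w\to\Lambda'_{w'}$ induced by $\psi$. For the datum $(\Lambda',w',\mathscr{H}',\varepsilon')$ the corresponding objects are written $\Phi'$, $\widetilde\Lambda'$, $\widetilde\Phi'$, $X'_{\tilde\alpha}$, $\mathfrak{h}'$. *)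

theory Defs
  imports "HOL-Algebra.Free_Abelian_Groups" "HOL-Algebra.Algebraic_Closure_Type"
begin

section \<open>Lattices\<close>

text \<open>
  The underlying abelian group of a lattice is a type of class \<open>ab_group_add\<close>; the lattice
  structure is its form \<open>B\<close>.  The group-theoretic notions of HOL-Algebra are applied to the
  following group.
\<close>

definition add_grp :: "'l::ab_group_add monoid" where
  "add_grp = \<lparr>carrier = UNIV, monoid.mult = (+), one = 0\<rparr>"

definition is_lattice :: "('l::ab_group_add \<Rightarrow> 'l \<Rightarrow> int) \<Rightarrow> bool" where
  "is_lattice B \<longleftrightarrow>
     (\<exists>n::nat. (add_grp :: 'l monoid) \<cong> free_Abelian_group {..<n}) \<and>
     (\<forall>x y. B x y = B y x) \<and>
     (\<forall>x y z. B (x + y) z = B x z + B y z) \<and>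
     (\<forall>x. x \<noteq> 0 \<longrightarrow> B x x > 0)"

definition roots :: "('l::ab_group_add \<Rightarrow> 'l \<Rightarrow> int) \<Rightarrow> 'l set" where
  "roots B = {\<alpha>. B \<alpha> \<alpha> = 2}"

definition simply_laced_root_lattice :: "('l::ab_group_add \<Rightarrow> 'l \<Rightarrow> int) \<Rightarrow> bool" where
  "simply_laced_root_lattice B \<longleftrightarrow> is_lattice B \<and> generate add_grp (roots B) = UNIV"

definition lattice_iso ::
  "('l::ab_group_add \<Rightarrow> 'l \<Rightarrow> int) \<Rightarrow> ('m::ab_group_add \<Rightarrow> 'm \<Rightarrow> int) \<Rightarrow> ('l \<Rightarrow> 'm) set" where
  "lattice_iso B B' = {\<psi> \<in> iso add_grp add_grp. \<forall>x y. B' (\<psi> x) (\<psi> y) = B x y}"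

definition has_order :: "('l \<Rightarrow> 'l) \<Rightarrow> nat \<Rightarrow> bool" where
  "has_order w d \<longleftrightarrow> d > 0 \<and> w ^^ d = id \<and> (\<forall>j. 0 < j \<and> j < d \<longrightarrow> w ^^ j \<noteq> id)"

definition coinv_ker :: "('l::ab_group_add \<Rightarrow> 'l) \<Rightarrow> 'l set" where
  "coinv_ker w = range (\<lambda>x. x - w x)"

definition coinv :: "('l::ab_group_add \<Rightarrow> 'l) \<Rightarrow> 'l set monoid" where
  "coinv w = add_grp Mod coinv_ker w"

definition coinv_class :: "('l::ab_group_add \<Rightarrow> 'l) \<Rightarrow> 'l \<Rightarrow> 'l set" where
  "coinv_class w x = coinv_ker w #>\<^bsub>add_grp\<^esub> x"

definition elliptic :: "('l::ab_group_add \<Rightarrow> 'l) \<Rightarrow> bool" where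
  "elliptic w \<longleftrightarrow> finite (carrier (coinv w))"


section \<open>Central extensions\<close>

definition primitive_root_of_unity :: "'k::field \<Rightarrow> nat \<Rightarrow> bool" where
  "primitive_root_of_unity \<zeta> d \<longleftrightarrow>
     d > 0 \<and> \<zeta> ^ d = 1 \<and> (\<forall>j. 0 < j \<and> j < d \<longrightarrow> \<zeta> ^ j \<noteq> 1)"

text \<open>The cyclic group generated by \<open>\<zeta>\<close>; natural powers suffice for a root of unity.\<close>

definition mu :: "'k::field \<Rightarrow> 'k monoid" where
  "mu \<zeta> = \<lparr>carrier = range (\<lambda>i::nat. \<zeta> ^ i), monoid.mult = (*), one = 1\<rparr>"

definition central_extension ::
  "'a monoid \<Rightarrow> 'e monoid \<Rightarrow> 'q monoid \<Rightarrow> ('a \<Rightarrow> 'e) \<Rightarrow> ('e \<Rightarrow> 'q) \<Rightarrow> bool" where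
  "central_extension A E Q i p \<longleftrightarrow>
     group A \<and> group E \<and> group Q \<and>
     i \<in> hom A E \<and> inj_on i (carrier A) \<and>
     p \<in> hom E Q \<and> p ` carrier E = carrier Q \<and>
     i ` carrier A = kernel E Q p \<and>
     (\<forall>a \<in> carrier A. \<forall>x \<in> carrier E. i a \<otimes>\<^bsub>E\<^esub> x = x \<otimes>\<^bsub>E\<^esub> i a)"

text \<open>
  The commutator pairing on \<open>Q\<close> sends \<open>x, y\<close> to the commutator of any lifts to \<open>E\<close>.  When \<open>Q\<close> is
  abelian the commutator lies in the image of \<open>A\<close>, and it does not depend on the lifts.
\<close>

definition commutator_pairing ::
  "'a monoid \<Rightarrow> 'e monoid \<Rightarrow> ('a \<Rightarrow> 'e) \<Rightarrow> ('e \<Rightarrow> 'q) \<Rightarrow> 'q \<Rightarrow> 'q \<Rightarrow> 'a" where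
  "commutator_pairing A E i p x y =
     (THE c. c \<in> carrier A \<and>
        (\<forall>g \<in> carrier E. \<forall>h \<in> carrier E. p g = x \<and> p h = y \<longrightarrow>
           i c = g \<otimes>\<^bsub>E\<^esub> h \<otimes>\<^bsub>E\<^esub> inv\<^bsub>E\<^esub> g \<otimes>\<^bsub>E\<^esub> inv\<^bsub>E\<^esub> h))"


section \<open>Input data\<close>

text \<open>
  The central extension is the group \<open>ext\<close> together with its inclusion \<open>emb\<close> of the group generated
  by \<open>\<zeta>\<close> and its projection \<open>proj\<close> to the coinvariants, whose elements are cosets.
\<close>

record ('l, 'h, 'k) datum =
  lform :: "'l \<Rightarrow> 'l \<Rightarrow> int"
  laut :: "'l \<Rightarrow> 'l"
  ext :: "'h monoid"
  emb :: "'k \<Rightarrow> 'h"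
  proj :: "'h \<Rightarrow> 'l set"
  eps :: "'l \<Rightarrow> 'l \<Rightarrow> 'k"

definition pairing ::
  "'k::field \<Rightarrow> ('l::ab_group_add, 'h, 'k) datum \<Rightarrow> 'l \<Rightarrow> 'l \<Rightarrow> 'k" where
  "pairing \<zeta> D \<alpha> \<beta> = commutator_pairing (mu \<zeta>) (ext D) (emb D) (proj D)
     (coinv_class (laut D) \<alpha>) (coinv_class (laut D) \<beta>)"

definition input_datum ::
  "'k::field_char_0 \<Rightarrow> ('l::ab_group_add, 'h, 'k) datum \<Rightarrow> bool" where
  "input_datum \<zeta> D \<longleftrightarrow>
     simply_laced_root_lattice (lform D) \<and>
     laut D \<in> lattice_iso (lform D) (lform D) \<and>
     elliptic (laut D) \<and>
     (\<exists>d. has_order (laut D) d \<and> primitive_root_of_unity \<zeta> d) \<and>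
     central_extension (mu \<zeta>) (ext D) (coinv (laut D)) (emb D) (proj D) \<and>
     (\<forall>\<alpha> \<beta>. eps D \<alpha> \<beta> \<noteq> 0) \<and>
     (\<forall>\<alpha> \<beta> \<gamma>. eps D (\<alpha> + \<beta>) \<gamma> = eps D \<alpha> \<gamma> * eps D \<beta> \<gamma>) \<and>
     (\<forall>\<alpha> \<beta> \<gamma>. eps D \<alpha> (\<beta> + \<gamma>) = eps D \<alpha> \<beta> * eps D \<alpha> \<gamma>) \<and>
     (\<forall>\<alpha> \<beta>. lform D \<alpha> \<beta> = -1 \<longrightarrow> eps D \<alpha> \<beta> / eps D \<beta> \<alpha> = - pairing \<zeta> D \<beta> \<alpha>) \<and>
     (\<forall>\<alpha> \<beta>. eps D (laut D \<alpha>) (laut D \<beta>) = eps D \<alpha> \<beta>)"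

definition datum_iso ::
  "'k::field_char_0 \<Rightarrow> ('l::ab_group_add, 'h, 'k) datum \<Rightarrow> ('m::ab_group_add, 'g, 'k) datum \<Rightarrow>
   ('l \<Rightarrow> 'm) \<Rightarrow> ('h \<Rightarrow> 'g) \<Rightarrow> bool" where
  "datum_iso \<zeta> D D' \<psi> \<phi> \<longleftrightarrow>
     \<psi> \<in> lattice_iso (lform D) (lform D') \<and>
     \<psi> \<circ> laut D = laut D' \<circ> \<psi> \<and>
     (\<forall>\<alpha> \<beta>. eps D' (\<psi> \<alpha>) (\<psi> \<beta>) = eps D \<alpha> \<beta>) \<and>
     \<phi> \<in> iso (ext D) (ext D') \<and>
     (\<forall>c \<in> carrier (mu \<zeta>). \<phi> (emb D c) = emb D' c) \<and>
     (\<forall>h \<in> carrier (ext D). \<forall>x. proj D h = coinv_class (laut D) x \<longrightarrow>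
        proj D' (\<phi> h) = coinv_class (laut D') (\<psi> x))"

definition lat_ext :: "('l::ab_group_add, 'h, 'k) datum \<Rightarrow> ('l \<times> 'h) monoid" where
  "lat_ext D = (add_grp \<times>\<times> ext D)
     \<lparr>carrier := {(x, h). h \<in> carrier (ext D) \<and> coinv_class (laut D) x = proj D h}\<rparr>"

definition lat_emb :: "('l::ab_group_add, 'h, 'k) datum \<Rightarrow> 'k \<Rightarrow> 'l \<times> 'h" where
  "lat_emb D c = (0, emb D c)"

definition ext_roots :: "('l::ab_group_add, 'h, 'k) datum \<Rightarrow> ('l \<times> 'h) set" where
  "ext_roots D = {a \<in> carrier (lat_ext D). fst a \<in> roots (lform D)}"

definition central_scalar ::
  "'k::field \<Rightarrow> ('l::ab_group_add, 'h, 'k) datum \<Rightarrow> 'l \<times> 'h \<Rightarrow> 'k" where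
  "central_scalar \<zeta> D a = (THE c. c \<in> carrier (mu \<zeta>) \<and> lat_emb D c = a)"


section \<open>Vector spaces and Lie algebras\<close>

text \<open>
  Vector spaces over \<open>'k\<close> are \<open>module\<close> records over \<open>ring_of_type_algebra\<close>.  The record also has
  ring fields: \<open>mult\<close> holds the bracket of a Lie algebra (and is unspecified for a mere vector
  space), \<open>one\<close> is never used.
\<close>

definition linear_maps ::
  "('k::field, 'v) module \<Rightarrow> ('k, 'u) module \<Rightarrow> ('v \<Rightarrow> 'u) set" where
  "linear_maps V W = {f \<in> carrier V \<rightarrow> carrier W.
     (\<forall>x \<in> carrier V. \<forall>y \<in> carrier V. f (x \<oplus>\<^bsub>V\<^esub> y) = f x \<oplus>\<^bsub>W\<^esub> f y) \<and>
     (\<forall>c. \<forall>x \<in> carrier V. f (c \<odot>\<^bsub>V\<^esub> x) = c \<odot>\<^bsub>W\<^esub> f x)}"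

definition lie_iso ::
  "('k::field, 'v) module \<Rightarrow> ('k, 'u) module \<Rightarrow> ('v \<Rightarrow> 'u) set" where
  "lie_iso L M = {f \<in> linear_maps L M. bij_betw f (carrier L) (carrier M) \<and>
     (\<forall>x \<in> carrier L. \<forall>y \<in> carrier L. f (x \<otimes>\<^bsub>L\<^esub> y) = f x \<otimes>\<^bsub>M\<^esub> f y)}"

definition free_space :: "'x set \<Rightarrow> ('k::field, 'x \<Rightarrow>\<^sub>0 'k) module" where
  "free_space S = \<lparr>carrier = {f. Poly_Mapping.keys f \<subseteq> S}, monoid.mult = undefined, one = undefined,
     ring.zero = 0, ring.add = (+), module.smult = (\<lambda>c. Poly_Mapping.map ((*) c))\<rparr>"

definition span_in :: "('k::field, 'v) module \<Rightarrow> 'v set \<Rightarrow> 'v set" where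
  "span_in V G = (\<lambda>N. submodule N ring_of_type_algebra V) hull G"

definition quotient_space ::
  "('k::field, 'v) module \<Rightarrow> 'v set \<Rightarrow> ('k, 'v set) module" where
  "quotient_space V N = \<lparr>carrier = a_rcosets\<^bsub>V\<^esub> N, monoid.mult = undefined, one = undefined,
     ring.zero = N, ring.add = set_add V, module.smult = (\<lambda>c A. \<Union>x\<in>A. N +>\<^bsub>V\<^esub> (c \<odot>\<^bsub>V\<^esub> x))\<rparr>"

definition direct_sum ::
  "('k::field, 'v) module \<Rightarrow> ('k, 'u) module \<Rightarrow> ('k, 'v \<times> 'u) module" where
  "direct_sum V W = \<lparr>carrier = carrier V \<times> carrier W, monoid.mult = undefined, one = undefined,
     ring.zero = (\<zero>\<^bsub>V\<^esub>, \<zero>\<^bsub>W\<^esub>),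
     ring.add = (\<lambda>(v, u) (v', u'). (v \<oplus>\<^bsub>V\<^esub> v', u \<oplus>\<^bsub>W\<^esub> u')),
     module.smult = (\<lambda>c (v, u). (c \<odot>\<^bsub>V\<^esub> v, c \<odot>\<^bsub>W\<^esub> u))\<rparr>"


section \<open>The Lie algebra of an input datum\<close>

definition t_space :: "('k::field, 'l::ab_group_add \<Rightarrow> 'k) module" where
  "t_space = \<lparr>carrier = {s. \<forall>x y. s (x + y) = s x + s y}, monoid.mult = undefined, one = undefined,
     ring.zero = (\<lambda>_. 0), ring.add = (\<lambda>s s' x. s x + s' x), module.smult = (\<lambda>c s x. c * s x)\<rparr>"

definition l_relations ::
  "'k::field \<Rightarrow> ('l::ab_group_add, 'h, 'k) datum \<Rightarrow> (('l \<times> 'h) \<Rightarrow>\<^sub>0 'k) set" where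
  "l_relations \<zeta> D = span_in (free_space (ext_roots D))
     {Poly_Mapping.single (lat_emb D \<zeta> \<otimes>\<^bsub>lat_ext D\<^esub> a) 1 - Poly_Mapping.single a \<zeta> |a.
        a \<in> ext_roots D}"

definition l_space ::
  "'k::field \<Rightarrow> ('l::ab_group_add, 'h, 'k) datum \<Rightarrow> ('k, (('l \<times> 'h) \<Rightarrow>\<^sub>0 'k) set) module" where
  "l_space \<zeta> D = quotient_space (free_space (ext_roots D)) (l_relations \<zeta> D)"

type_synonym ('l, 'h, 'k) h_elem = "('l \<Rightarrow> 'k) \<times> (('l \<times> 'h) \<Rightarrow>\<^sub>0 'k) set"

definition h_space ::
  "'k::field \<Rightarrow> ('l::ab_group_add, 'h, 'k) datum \<Rightarrow> ('k, ('l, 'h, 'k) h_elem) module" where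
  "h_space \<zeta> D = direct_sum t_space (l_space \<zeta> D)"

text \<open>The elements \<open>\<alpha>\<^sup>\<or>\<close> and \<open>X\<^sub>a\<close> of the direct sum.\<close>

definition coroot ::
  "'k::field \<Rightarrow> ('l::ab_group_add, 'h, 'k) datum \<Rightarrow> 'l \<Rightarrow> ('l, 'h, 'k) h_elem" where
  "coroot \<zeta> D \<alpha> = (\<lambda>x. of_int (lform D \<alpha> x), \<zero>\<^bsub>l_space \<zeta> D\<^esub>)"

definition X_elem ::
  "'k::field \<Rightarrow> ('l::ab_group_add, 'h, 'k) datum \<Rightarrow> 'l \<times> 'h \<Rightarrow> ('l, 'h, 'k) h_elem" where
  "X_elem \<zeta> D a = (\<zero>\<^bsub>t_space\<^esub>,
     l_relations \<zeta> D +>\<^bsub>free_space (ext_roots D)\<^esub> Poly_Mapping.single a 1)"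

definition h_bracket ::
  "'k::field \<Rightarrow> ('l::ab_group_add, 'h, 'k) datum \<Rightarrow>
   (('l, 'h, 'k) h_elem \<Rightarrow> ('l, 'h, 'k) h_elem \<Rightarrow> ('l, 'h, 'k) h_elem) \<Rightarrow> bool" where
  "h_bracket \<zeta> D br \<longleftrightarrow> (let V = h_space \<zeta> D; \<Phi> = roots (lform D) in
     (\<forall>x \<in> carrier V. br x \<in> linear_maps V V \<and> (\<lambda>y. br y x) \<in> linear_maps V V) \<and>
     (\<forall>s \<in> carrier t_space. \<forall>s' \<in> carrier t_space.
        br (s, \<zero>\<^bsub>l_space \<zeta> D\<^esub>) (s', \<zero>\<^bsub>l_space \<zeta> D\<^esub>) = \<zero>\<^bsub>V\<^esub>) \<and>
     (\<forall>\<alpha> \<in> \<Phi>. \<forall>b \<in> ext_roots D.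
        br (coroot \<zeta> D \<alpha>) (X_elem \<zeta> D b) = of_int (lform D \<alpha> (fst b)) \<odot>\<^bsub>V\<^esub> X_elem \<zeta> D b \<and>
        \<ominus>\<^bsub>V\<^esub> br (X_elem \<zeta> D b) (coroot \<zeta> D \<alpha>) = of_int (lform D \<alpha> (fst b)) \<odot>\<^bsub>V\<^esub> X_elem \<zeta> D b) \<and>
     (\<forall>a \<in> ext_roots D. \<forall>b \<in> ext_roots D.
        br (X_elem \<zeta> D a) (X_elem \<zeta> D b) =
          (if fst a + fst b = 0 then
             (eps D (fst a) (fst b) * central_scalar \<zeta> D (a \<otimes>\<^bsub>lat_ext D\<^esub> b)) \<odot>\<^bsub>V\<^esub> coroot \<zeta> D (fst a)
           else if fst a + fst b \<in> \<Phi> then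
             eps D (fst a) (fst b) \<odot>\<^bsub>V\<^esub> X_elem \<zeta> D (a \<otimes>\<^bsub>lat_ext D\<^esub> b)
           else \<zero>\<^bsub>V\<^esub>)))"

text \<open>
  The coroots and the \<open>X\<^sub>a\<close> span the space, so \<open>h_bracket\<close> determines the bracket on the carrier; the
  choice only concerns its irrelevant values outside the carrier.
\<close>

definition h_lie ::
  "'k::field \<Rightarrow> ('l::ab_group_add, 'h, 'k) datum \<Rightarrow> ('k, ('l, 'h, 'k) h_elem) module" where
  "h_lie \<zeta> D = (h_space \<zeta> D)\<lparr>monoid.mult := (SOME br. h_bracket \<zeta> D br)\<rparr>"

definition induced_map ::
  "'k::field \<Rightarrow> ('l::ab_group_add, 'h, 'k) datum \<Rightarrow> ('m::ab_group_add, 'g, 'k) datum \<Rightarrow>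
   ('l \<Rightarrow> 'm) \<Rightarrow> ('h \<Rightarrow> 'g) \<Rightarrow> (('l, 'h, 'k) h_elem \<Rightarrow> ('m, 'g, 'k) h_elem) \<Rightarrow> bool" where
  "induced_map \<zeta> D D' \<psi> \<phi> f \<longleftrightarrow>
     f \<in> linear_maps (h_lie \<zeta> D) (h_lie \<zeta> D') \<and>
     (\<forall>\<alpha> \<in> roots (lform D). f (coroot \<zeta> D \<alpha>) = coroot \<zeta> D' (\<psi> \<alpha>)) \<and>
     (\<forall>a \<in> ext_roots D. f (X_elem \<zeta> D a) = X_elem \<zeta> D' (map_prod \<psi> \<phi> a))"

end

theory Submission
  imports Defs
begin

text \<open>
  The Lie bracket is chosen by \<open>SOME\<close> among the bilinear maps with the prescribed values on the
  \<open>\<alpha>\<^sup>\<or>\<close> and the \<open>X\<^sub>a\<close>, so nothing is known about it unless such a map exists and is unique.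
  Existence: the formulas extend bilinearly to the free space on the roots of the extension and
  respect the relations \<open>X\<^bsub>\<zeta>a\<^esub> = \<zeta> X\<^sub>a\<close>, as \<open>\<zeta>\<close> is central.
  Uniqueness: the form is positive definite and the characteristic is zero, so Gram-Schmidt
  orthogonalisation with integer coefficients shows that the coroots span \<open>Hom(\<Lambda>, k)\<close>.
  Hence linear maps that agree on the \<open>\<alpha>\<^sup>\<or>\<close> and the \<open>X\<^sub>a\<close> are equal.  This gives the uniqueness of
  the induced map and its compatibility with the brackets, and shows that the map induced by the
  inverse pair is its inverse.
\<close>

section \<open>Vector spaces\<close>

text \<open>The obstacle is that neither summand comes with a preferred basis: the root part would
  get one only from a section of the extension over the roots. So bilinear maps are first defined on
  the free space over all of \<open>ext_roots D\<close>, where arbitrary values extend. They descend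
  because \<open>eps\<close> and the case distinction in the bracket see only the projection to the
  lattice, which multiplication by the central element over \<open>\<zeta>\<close> leaves unchanged.
  For the torus, the lattice is a bare abelian group, so orthogonalisation is done with integer
  multiples that clear all denominators. Positive definiteness makes the pivots
  \<open>(p, p)\<close> positive, and characteristic zero keeps nonzero integers invertible in
  \<open>'k\<close>. The outcome is a combination of coroots that matches a given functional on any
  finite set; finite generation of the lattice upgrades this to equality. On functionals the induced
  map is precomposition with the inverse of \<open>\<psi>\<close> instead of an extension from the
  coroots, so linear relations among coroots need no inspection.\<close>

abbreviation scalars :: "'k::field ring" where
  "scalars \<equiv> ring_of_type_algebra"

lemma scalars_simps [simp]:
  "carrier (scalars :: 'k::field ring) = UNIV"
  "x \<otimes>\<^bsub>scalars\<^esub> y = x * (y::'k::field)"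
  "x \<oplus>\<^bsub>scalars\<^esub> y = x + (y::'k::field)"
  "\<one>\<^bsub>scalars\<^esub> = (1::'k::field)"
  "\<zero>\<^bsub>scalars\<^esub> = (0::'k::field)"
  by (simp_all add: ring_of_type_algebra_def)

text \<open>Additive inverses come from the scalar action: \<open>(-1) x + x = 0 x\<close>, which
  the last assumption makes zero.\<close>

lemma moduleI_scalars:
  fixes V :: "('k::field, 'v) module"
  assumes "\<And>x y. \<lbrakk>x \<in> carrier V; y \<in> carrier V\<rbrakk> \<Longrightarrow> x \<oplus>\<^bsub>V\<^esub> y \<in> carrier V"
    and "\<zero>\<^bsub>V\<^esub> \<in> carrier V"
    and "\<And>x y z. \<lbrakk>x \<in> carrier V; y \<in> carrier V; z \<in> carrier V\<rbrakk> \<Longrightarrow> (x \<oplus>\<^bsub>V\<^esub> y) \<oplus>\<^bsub>V\<^esub> z = x \<oplus>\<^bsub>V\<^esub> (y \<oplus>\<^bsub>V\<^esub> z)"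
    and "\<And>x y. \<lbrakk>x \<in> carrier V; y \<in> carrier V\<rbrakk> \<Longrightarrow> x \<oplus>\<^bsub>V\<^esub> y = y \<oplus>\<^bsub>V\<^esub> x"
    and "\<And>x. x \<in> carrier V \<Longrightarrow> \<zero>\<^bsub>V\<^esub> \<oplus>\<^bsub>V\<^esub> x = x"
    and "\<And>c x. x \<in> carrier V \<Longrightarrow> c \<odot>\<^bsub>V\<^esub> x \<in> carrier V"
    and "\<And>c d x. x \<in> carrier V \<Longrightarrow> (c + d) \<odot>\<^bsub>V\<^esub> x = c \<odot>\<^bsub>V\<^esub> x \<oplus>\<^bsub>V\<^esub> d \<odot>\<^bsub>V\<^esub> x"
    and "\<And>c x y. \<lbrakk>x \<in> carrier V; y \<in> carrier V\<rbrakk> \<Longrightarrow> c \<odot>\<^bsub>V\<^esub> (x \<oplus>\<^bsub>V\<^esub> y) = c \<odot>\<^bsub>V\<^esub> x \<oplus>\<^bsub>V\<^esub> c \<odot>\<^bsub>V\<^esub> y"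
    and "\<And>c d x. x \<in> carrier V \<Longrightarrow> (c * d) \<odot>\<^bsub>V\<^esub> x = c \<odot>\<^bsub>V\<^esub> (d \<odot>\<^bsub>V\<^esub> x)"
    and "\<And>x. x \<in> carrier V \<Longrightarrow> 1 \<odot>\<^bsub>V\<^esub> x = x"
    and "\<And>x. x \<in> carrier V \<Longrightarrow> 0 \<odot>\<^bsub>V\<^esub> x = \<zero>\<^bsub>V\<^esub>"
  shows "module scalars V"
proof (rule moduleI)
  show "abelian_group V"
  proof (rule abelian_groupI)
    fix x assume "x \<in> carrier V"
    then have "(-1) \<odot>\<^bsub>V\<^esub> x \<oplus>\<^bsub>V\<^esub> x = \<zero>\<^bsub>V\<^esub>"
      using assms(7)[of x "-1" 1] assms(10,11) by simp
    then show "\<exists>y\<in>carrier V. y \<oplus>\<^bsub>V\<^esub> x = \<zero>\<^bsub>V\<^esub>"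
      using assms(6) \<open>x \<in> carrier V\<close> by blast
  qed (use assms in auto)
qed (use assms cring_from_type_algebra in auto)

text \<open>The inverse in a module record is fixed only implicitly by its addition. Rewriting it as
  a scalar multiple makes it computable in free spaces and in \<open>h_space\<close>, and reduces
  closure under inverses to closure under scalars.\<close>

lemma a_inv_eq_smult:
  fixes V :: "('k::field, 'v) module"
  assumes "module scalars V" and "x \<in> carrier V"
  shows "\<ominus>\<^bsub>V\<^esub> x = (-1) \<odot>\<^bsub>V\<^esub> x"
proof -
  interpret module scalars V by fact
  have "x \<oplus>\<^bsub>V\<^esub> (-1) \<odot>\<^bsub>V\<^esub> x = 0 \<odot>\<^bsub>V\<^esub> x"
    using smult_l_distr[of 1 "-1" x] assms(2) smult_one[of x] by simp
  then have "x \<oplus>\<^bsub>V\<^esub> (-1) \<odot>\<^bsub>V\<^esub> x = \<zero>\<^bsub>V\<^esub>"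
    using smult_l_null assms(2) by simp
  then show ?thesis
    by (simp add: M.add.inv_equality M.a_comm assms(2))
qed

lemma submodule_scalarsI:
  fixes V :: "('k::field, 'v) module"
  assumes V: "module scalars V" and sub: "H \<subseteq> carrier V" and zero: "\<zero>\<^bsub>V\<^esub> \<in> H"
    and "\<And>a b. \<lbrakk>a \<in> H; b \<in> H\<rbrakk> \<Longrightarrow> a \<oplus>\<^bsub>V\<^esub> b \<in> H"
    and smult: "\<And>c x. x \<in> H \<Longrightarrow> c \<odot>\<^bsub>V\<^esub> x \<in> H"
  shows "submodule H scalars V"
proof (rule module.submoduleI[OF V])
  show "\<ominus>\<^bsub>V\<^esub> a \<in> H" if "a \<in> H" for a
    using that sub a_inv_eq_smult[OF V, of a] smult by auto
qed (use assms in auto)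

section \<open>Spans as smallest subspaces\<close>

lemma mem_span_in_iff:
  "x \<in> span_in V G \<longleftrightarrow> (\<forall>H. submodule H scalars V \<longrightarrow> G \<subseteq> H \<longrightarrow> x \<in> H)"
  by (auto simp: span_in_def hull_def)

lemma submodule_span_in:
  fixes V :: "('k::field, 'v) module"
  assumes V: "module scalars V" and G: "G \<subseteq> carrier V"
  shows "submodule (span_in V G) scalars V"
proof (rule submodule_scalarsI[OF V])
  note E = module.submoduleE[OF V]
  show "span_in V G \<subseteq> carrier V"
    using module.carrier_is_submodule[OF V] G by (simp add: subset_iff mem_span_in_iff)
  show "\<zero>\<^bsub>V\<^esub> \<in> span_in V G"
    unfolding mem_span_in_iff using subgroup.one_closed[OF submodule.axioms(1), of _ scalars V] by simp
  show "a \<oplus>\<^bsub>V\<^esub> b \<in> span_in V G" if "a \<in> span_in V G" "b \<in> span_in V G" for a b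
    unfolding mem_span_in_iff
  proof (intro allI impI)
    fix H assume "submodule H scalars V" "G \<subseteq> H"
    then show "a \<oplus>\<^bsub>V\<^esub> b \<in> H"
      by (intro E(5)) (use that in \<open>simp_all add: mem_span_in_iff\<close>)
  qed
  show "c \<odot>\<^bsub>V\<^esub> x \<in> span_in V G" if "x \<in> span_in V G" for c x
    unfolding mem_span_in_iff
  proof (intro allI impI)
    fix H assume "submodule H scalars V" "G \<subseteq> H"
    then show "c \<odot>\<^bsub>V\<^esub> x \<in> H"
      by (intro E(4)) (use that in \<open>simp_all add: mem_span_in_iff\<close>)
  qed
qed

lemma span_in_superset: "G \<subseteq> span_in V G"
  unfolding span_in_def by (rule hull_subset)

text \<open>The elements of the carrier that satisfy \<open>P\<close> form a submodule containing
  \<open>G\<close>, so the hull lies inside it.\<close>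

lemma span_in_induct [consumes 3, case_names zero base add smult]:
  fixes V :: "('k::field, 'v) module"
  assumes V: "module scalars V" and G: "G \<subseteq> carrier V" and x: "x \<in> span_in V G"
    and "P \<zero>\<^bsub>V\<^esub>"
    and "\<And>g. g \<in> G \<Longrightarrow> P g"
    and "\<And>a b. \<lbrakk>a \<in> carrier V; b \<in> carrier V; P a; P b\<rbrakk> \<Longrightarrow> P (a \<oplus>\<^bsub>V\<^esub> b)"
    and "\<And>c a. \<lbrakk>a \<in> carrier V; P a\<rbrakk> \<Longrightarrow> P (c \<odot>\<^bsub>V\<^esub> a)"
  shows "P x"
proof -
  interpret module scalars V by fact
  have "submodule {x \<in> carrier V. P x} scalars V"
  proof (rule submodule_scalarsI[OF V])
    show "a \<oplus>\<^bsub>V\<^esub> b \<in> {x \<in> carrier V. P x}" if "a \<in> {x \<in> carrier V. P x}" "b \<in> {x \<in> carrier V. P x}" for a b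
      using that assms(6) by simp
    show "c \<odot>\<^bsub>V\<^esub> a \<in> {x \<in> carrier V. P x}" if "a \<in> {x \<in> carrier V. P x}" for c a
      using that assms(7) smult_closed[of c a] by simp
  qed (use assms(4) in auto)
  moreover have "G \<subseteq> {x \<in> carrier V. P x}"
    using G assms(5) by blast
  ultimately show ?thesis
    using x unfolding mem_span_in_iff by blast
qed

section \<open>Quotient spaces\<close>

lemma abelian_subgroup_submodule:
  assumes "module R V" and "submodule N R V"
  shows "abelian_subgroup N V"
proof (rule abelian_subgroupI3)
  show "additive_subgroup N V"
    using submodule.axioms(1)[OF assms(2)] by (rule additive_subgroup.intro)
  show "abelian_group V"
    using assms(1) by (rule module.axioms(2))
qed

lemma
  fixes V :: "('k::field, 'v) module"
  assumes V: "module scalars V" and N: "submodule N scalars V"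
  shows quotient_add: "\<And>x y. \<lbrakk>x \<in> carrier V; y \<in> carrier V\<rbrakk> \<Longrightarrow>
      (N +>\<^bsub>V\<^esub> x) \<oplus>\<^bsub>quotient_space V N\<^esub> (N +>\<^bsub>V\<^esub> y) = N +>\<^bsub>V\<^esub> (x \<oplus>\<^bsub>V\<^esub> y)"
    and quotient_zero: "\<zero>\<^bsub>quotient_space V N\<^esub> = N +>\<^bsub>V\<^esub> \<zero>\<^bsub>V\<^esub>"
    and quotient_smult: "\<And>c x. x \<in> carrier V \<Longrightarrow>
      c \<odot>\<^bsub>quotient_space V N\<^esub> (N +>\<^bsub>V\<^esub> x) = N +>\<^bsub>V\<^esub> (c \<odot>\<^bsub>V\<^esub> x)"
    and quotient_eq_iff: "\<And>x y. \<lbrakk>x \<in> carrier V; y \<in> carrier V\<rbrakk> \<Longrightarrow>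
      N +>\<^bsub>V\<^esub> x = N +>\<^bsub>V\<^esub> y \<longleftrightarrow> x \<ominus>\<^bsub>V\<^esub> y \<in> N"
    and carrier_quotient: "carrier (quotient_space V N) = (\<lambda>x. N +>\<^bsub>V\<^esub> x) ` carrier V"
proof -
  interpret module scalars V by fact
  interpret S: abelian_subgroup N V
    by (rule abelian_subgroup_submodule[OF V N])
  note E = submoduleE[OF N]
  show add: "(N +>\<^bsub>V\<^esub> x) \<oplus>\<^bsub>quotient_space V N\<^esub> (N +>\<^bsub>V\<^esub> y) = N +>\<^bsub>V\<^esub> (x \<oplus>\<^bsub>V\<^esub> y)"
    if "x \<in> carrier V" "y \<in> carrier V" for x y
    using S.a_rcos_sum[OF that] by (simp add: quotient_space_def)
  show zero: "\<zero>\<^bsub>quotient_space V N\<^esub> = N +>\<^bsub>V\<^esub> \<zero>\<^bsub>V\<^esub>"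
    by (simp add: quotient_space_def S.a_subset)
  show eq: "N +>\<^bsub>V\<^esub> x = N +>\<^bsub>V\<^esub> y \<longleftrightarrow> x \<ominus>\<^bsub>V\<^esub> y \<in> N" if "x \<in> carrier V" "y \<in> carrier V" for x y
  proof -
    have "N +>\<^bsub>V\<^esub> x = N +>\<^bsub>V\<^esub> y \<longleftrightarrow> x \<in> N +>\<^bsub>V\<^esub> y"
      using S.a_rcos_self[OF that(1)] a_repr_independence[OF _ that(2) S.a_subgroup, of x] by blast
    then show ?thesis
      using S.a_rcos_module[OF that(2,1)] by (simp add: a_minus_def)
  qed
  show smult: "c \<odot>\<^bsub>quotient_space V N\<^esub> (N +>\<^bsub>V\<^esub> x) = N +>\<^bsub>V\<^esub> (c \<odot>\<^bsub>V\<^esub> x)" if x: "x \<in> carrier V" for c x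
  proof -
    \<comment> \<open>Another representative \<open>n + x\<close> changes the scaled value by
      \<open>c n\<close>, which stays in \<open>N\<close>. Hence the union that defines the scalar
      action runs over copies of a single coset.\<close>
    have "N +>\<^bsub>V\<^esub> (c \<odot>\<^bsub>V\<^esub> y) = N +>\<^bsub>V\<^esub> (c \<odot>\<^bsub>V\<^esub> x)" if y: "y \<in> N +>\<^bsub>V\<^esub> x" for y
    proof -
      from y obtain n where n: "n \<in> N" "y = n \<oplus>\<^bsub>V\<^esub> x"
        by (auto simp: a_r_coset_def')
      then have nV: "n \<in> carrier V"
        using E(1) by auto
      have cn: "c \<odot>\<^bsub>V\<^esub> n \<in> N"
        using E(4)[of c n] n by simp
      have "c \<odot>\<^bsub>V\<^esub> y \<ominus>\<^bsub>V\<^esub> c \<odot>\<^bsub>V\<^esub> x = c \<odot>\<^bsub>V\<^esub> n"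
        using n nV x smult_r_distr[of c n x] smult_closed[of c n] smult_closed[of c x]
        by (simp add: a_minus_def a_assoc r_neg)
      then show ?thesis
        using eq[of "c \<odot>\<^bsub>V\<^esub> y" "c \<odot>\<^bsub>V\<^esub> x"] cn n nV x by simp
    qed
    then have "(\<Union>y\<in>N +>\<^bsub>V\<^esub> x. N +>\<^bsub>V\<^esub> (c \<odot>\<^bsub>V\<^esub> y)) = N +>\<^bsub>V\<^esub> (c \<odot>\<^bsub>V\<^esub> x)"
      using S.a_rcos_self[OF x] by blast
    then show ?thesis
      by (simp add: quotient_space_def)
  qed
  show carr: "carrier (quotient_space V N) = (\<lambda>x. N +>\<^bsub>V\<^esub> x) ` carrier V"
    by (auto simp: quotient_space_def A_RCOSETS_def')
qed

lemma module_quotient_space: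
  fixes V :: "('k::field, 'v) module"
  assumes V: "module scalars V" and N: "submodule N scalars V"
  shows "module scalars (quotient_space V N)"
proof -
  interpret module scalars V by fact
  note carr = carrier_quotient[OF V N]
    and add = quotient_add[OF V N] and zero = quotient_zero[OF V N] and smult = quotient_smult[OF V N]
  show ?thesis
  proof (rule moduleI_scalars)
    show "\<zero>\<^bsub>quotient_space V N\<^esub> \<in> carrier (quotient_space V N)"
      unfolding carr zero by blast
  next
    fix A B C assume "A \<in> carrier (quotient_space V N)" "B \<in> carrier (quotient_space V N)"
      "C \<in> carrier (quotient_space V N)"
    then obtain x y z where "A = N +>\<^bsub>V\<^esub> x" "x \<in> carrier V" "B = N +>\<^bsub>V\<^esub> y" "y \<in> carrier V"
      "C = N +>\<^bsub>V\<^esub> z" "z \<in> carrier V"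
      unfolding carr by blast
    then show "A \<oplus>\<^bsub>quotient_space V N\<^esub> B \<oplus>\<^bsub>quotient_space V N\<^esub> C
        = A \<oplus>\<^bsub>quotient_space V N\<^esub> (B \<oplus>\<^bsub>quotient_space V N\<^esub> C)"
      by (simp add: add a_assoc)
  next
    fix A B assume "A \<in> carrier (quotient_space V N)" "B \<in> carrier (quotient_space V N)"
    then obtain x y where xy: "A = N +>\<^bsub>V\<^esub> x" "x \<in> carrier V" "B = N +>\<^bsub>V\<^esub> y" "y \<in> carrier V"
      unfolding carr by blast
    then show "A \<oplus>\<^bsub>quotient_space V N\<^esub> B \<in> carrier (quotient_space V N)"
      by (simp add: add carr)
    show "A \<oplus>\<^bsub>quotient_space V N\<^esub> B = B \<oplus>\<^bsub>quotient_space V N\<^esub> A"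
      using xy by (simp add: add a_comm)
    show "c \<odot>\<^bsub>quotient_space V N\<^esub> (A \<oplus>\<^bsub>quotient_space V N\<^esub> B)
        = c \<odot>\<^bsub>quotient_space V N\<^esub> A \<oplus>\<^bsub>quotient_space V N\<^esub> c \<odot>\<^bsub>quotient_space V N\<^esub> B" for c
      using xy smult_r_distr[of c x y] by (simp add: add smult)
  next
    fix A c d assume "A \<in> carrier (quotient_space V N)"
    then obtain x where x: "A = N +>\<^bsub>V\<^esub> x" "x \<in> carrier V"
      unfolding carr by blast
    show "\<zero>\<^bsub>quotient_space V N\<^esub> \<oplus>\<^bsub>quotient_space V N\<^esub> A = A"
      unfolding zero using x by (simp add: add del: a_coset_add_zero)
    show "c \<odot>\<^bsub>quotient_space V N\<^esub> A \<in> carrier (quotient_space V N)"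
      using x by (simp add: smult carr)
    show "(c + d) \<odot>\<^bsub>quotient_space V N\<^esub> A
        = c \<odot>\<^bsub>quotient_space V N\<^esub> A \<oplus>\<^bsub>quotient_space V N\<^esub> d \<odot>\<^bsub>quotient_space V N\<^esub> A"
      using x smult_l_distr[of c d x] by (simp add: add smult)
    show "(c * d) \<odot>\<^bsub>quotient_space V N\<^esub> A = c \<odot>\<^bsub>quotient_space V N\<^esub> (d \<odot>\<^bsub>quotient_space V N\<^esub> A)"
      using x smult_assoc1[of c d x] by (simp add: smult)
    show "1 \<odot>\<^bsub>quotient_space V N\<^esub> A = A" "0 \<odot>\<^bsub>quotient_space V N\<^esub> A = \<zero>\<^bsub>quotient_space V N\<^esub>"
      using x smult_one[of x] smult_l_null[of x] by (simp_all add: smult zero del: a_coset_add_zero)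
  qed
qed

section \<open>Direct sums and linear maps\<close>

lemma direct_sum_simps:
  "carrier (direct_sum V W) = carrier V \<times> carrier W"
  "\<zero>\<^bsub>direct_sum V W\<^esub> = (\<zero>\<^bsub>V\<^esub>, \<zero>\<^bsub>W\<^esub>)"
  "x \<oplus>\<^bsub>direct_sum V W\<^esub> y = (fst x \<oplus>\<^bsub>V\<^esub> fst y, snd x \<oplus>\<^bsub>W\<^esub> snd y)"
  "c \<odot>\<^bsub>direct_sum V W\<^esub> x = (c \<odot>\<^bsub>V\<^esub> fst x, c \<odot>\<^bsub>W\<^esub> snd x)"
  by (simp_all add: direct_sum_def split: prod.splits)

lemma module_direct_sum:
  fixes V :: "('k::field, 'v) module" and W :: "('k, 'u) module"
  assumes "module scalars V" and "module scalars W"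
  shows "module scalars (direct_sum V W)"
proof -
  interpret V: module scalars V by fact
  interpret W: module scalars W by fact
  note V_simps = V.smult_l_distr[simplified scalars_simps] V.smult_r_distr[simplified scalars_simps]
    V.smult_assoc1[simplified scalars_simps] V.smult_one[simplified scalars_simps]
    V.smult_l_null[simplified scalars_simps] V.smult_closed[simplified scalars_simps]
  note W_simps = W.smult_l_distr[simplified scalars_simps] W.smult_r_distr[simplified scalars_simps]
    W.smult_assoc1[simplified scalars_simps] W.smult_one[simplified scalars_simps]
    W.smult_l_null[simplified scalars_simps] W.smult_closed[simplified scalars_simps]
  show ?thesis
    by (rule moduleI_scalars; simp only: direct_sum_simps mem_Times_iff prod.inject fst_conv snd_conv prod_eq_iff)
      (simp_all add: V_simps W_simps V.a_ac W.a_ac)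
qed

lemma module_t_space: "module scalars (t_space :: ('k::field, 'l::ab_group_add \<Rightarrow> 'k) module)"
  by (rule moduleI_scalars) (auto simp: t_space_def algebra_simps)

lemma linear_mapsD:
  assumes "f \<in> linear_maps V W"
  shows "x \<in> carrier V \<Longrightarrow> f x \<in> carrier W"
    and "\<lbrakk>x \<in> carrier V; y \<in> carrier V\<rbrakk> \<Longrightarrow> f (x \<oplus>\<^bsub>V\<^esub> y) = f x \<oplus>\<^bsub>W\<^esub> f y"
    and "x \<in> carrier V \<Longrightarrow> f (c \<odot>\<^bsub>V\<^esub> x) = c \<odot>\<^bsub>W\<^esub> f x"
  using assms by (auto simp: linear_maps_def)

lemma linear_maps_comp:
  "\<lbrakk>f \<in> linear_maps U V; g \<in> linear_maps V W\<rbrakk> \<Longrightarrow> (\<lambda>x. g (f x)) \<in> linear_maps U W"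
  by (simp add: linear_maps_def Pi_iff)

lemma linear_maps_zero:
  fixes V :: "('k::field, 'v) module" and W :: "('k, 'u) module"
  assumes V: "module scalars V" and W: "module scalars W" and f: "f \<in> linear_maps V W"
  shows "f \<zero>\<^bsub>V\<^esub> = \<zero>\<^bsub>W\<^esub>"
proof -
  interpret V: module scalars V by fact
  interpret W: module scalars W by fact
  have "f (0 \<odot>\<^bsub>V\<^esub> \<zero>\<^bsub>V\<^esub>) = 0 \<odot>\<^bsub>W\<^esub> f \<zero>\<^bsub>V\<^esub>"
    by (rule linear_mapsD(3)[OF f V.M.zero_closed])
  moreover have "f \<zero>\<^bsub>V\<^esub> \<in> carrier W"
    by (rule linear_mapsD(1)[OF f V.M.zero_closed])
  ultimately show ?thesis
    using V.smult_l_null[OF V.M.zero_closed] W.smult_l_null[of "f \<zero>\<^bsub>V\<^esub>"]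
    by (simp only: scalars_simps)
qed

section \<open>Linear extension from a basis\<close>

abbreviation pscale :: "'k::field \<Rightarrow> ('x \<Rightarrow>\<^sub>0 'k) \<Rightarrow> 'x \<Rightarrow>\<^sub>0 'k" where
  "pscale c \<equiv> Poly_Mapping.map ((*) c)"

lemma lookup_pscale [simp]: "Poly_Mapping.lookup (pscale c f) x = c * Poly_Mapping.lookup f x"
  by (simp add: Poly_Mapping.map.rep_eq when_def)

lemma vector_space_pscale: "vector_space (pscale :: 'k::field \<Rightarrow> ('x \<Rightarrow>\<^sub>0 'k) \<Rightarrow> _)"
  by unfold_locales (auto intro!: poly_mapping_eqI simp: lookup_add algebra_simps)

lemma keys_pscale: "Poly_Mapping.keys (pscale c f) \<subseteq> Poly_Mapping.keys f"
  by (auto simp: in_keys_iff)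

lemma pscale_diff: "pscale c (f - g) = pscale c f - pscale c g"
  by (rule poly_mapping_eqI) (simp add: lookup_minus right_diff_distrib)

lemma pscale_one [simp]: "pscale 1 f = f"
  by (rule poly_mapping_eqI) simp

lemma pscale_zero [simp]: "pscale c 0 = 0"
  by (rule poly_mapping_eqI) simp

lemma keys_add_closed:
  "\<lbrakk>Poly_Mapping.keys f \<subseteq> S; Poly_Mapping.keys g \<subseteq> S\<rbrakk> \<Longrightarrow> Poly_Mapping.keys (f + g) \<subseteq> S"
  by (rule order_trans[OF Poly_Mapping.keys_add Un_least])

lemma keys_pscale_closed: "Poly_Mapping.keys f \<subseteq> S \<Longrightarrow> Poly_Mapping.keys (pscale c f) \<subseteq> S"
  by (rule order_trans[OF keys_pscale])

lemma pscale_add: "pscale c (f + g) = pscale c f + pscale c g"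
  by (rule poly_mapping_eqI) (simp add: lookup_add distrib_left)

lemma vector_space_times: "vector_space ((*) :: 'k::field \<Rightarrow> 'k \<Rightarrow> 'k)"
  by unfold_locales (simp_all add: algebra_simps)

lemma sum_single_lookup: "f = (\<Sum>a\<in>Poly_Mapping.keys f. Poly_Mapping.single a (Poly_Mapping.lookup f a))"
  by (rule poly_mapping_eqI) (simp add: lookup_sum lookup_single when_def in_keys_iff)

lemma free_space_simps [simp]:
  "f \<in> carrier (free_space S) \<longleftrightarrow> Poly_Mapping.keys f \<subseteq> S"
  "f \<oplus>\<^bsub>free_space S\<^esub> g = f + g"
  "\<zero>\<^bsub>free_space S\<^esub> = 0"
  "c \<odot>\<^bsub>free_space S\<^esub> f = pscale c f"
  by (simp_all add: free_space_def)

lemma module_free_space: "module scalars (free_space S :: ('k::field, 'x \<Rightarrow>\<^sub>0 'k) module)"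
proof -
  interpret vector_space "pscale :: 'k \<Rightarrow> ('x \<Rightarrow>\<^sub>0 'k) \<Rightarrow> _"
    by (rule vector_space_pscale)
  show ?thesis
    by (rule moduleI_scalars)
      (auto simp: scale_right_distrib scale_left_distrib add.assoc add.commute
        dest: subsetD[OF Poly_Mapping.keys_add] subsetD[OF keys_pscale])
qed

lemma minus_free_space:
  assumes "f \<in> carrier (free_space S)" and "g \<in> carrier (free_space S)"
  shows "f \<ominus>\<^bsub>free_space S\<^esub> (g :: 'x \<Rightarrow>\<^sub>0 'k::field) = f - g"
proof -
  have "pscale (-1) g = - g"
    by (rule poly_mapping_eqI) simp
  then show ?thesis
    using a_inv_eq_smult[OF module_free_space assms(2)] by (simp add: a_minus_def)
qed

text \<open>The scalar action is a parameter because two targets occur: a free space for the root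
  part of the bracket, and the field itself for the torus part.\<close>

definition lin_ext :: "('k::field \<Rightarrow> 'v \<Rightarrow> 'v::ab_group_add) \<Rightarrow> ('x \<Rightarrow> 'v) \<Rightarrow> ('x \<Rightarrow>\<^sub>0 'k) \<Rightarrow> 'v" where
  "lin_ext sc g f = (\<Sum>a\<in>Poly_Mapping.keys f. sc (Poly_Mapping.lookup f a) (g a))"

context vector_space
begin

text \<open>Functions with different supports can be compared only over a common index set; indices
  outside the support contribute \<open>0\<close>.\<close>

lemma lin_ext_superset:
  assumes "finite A" and "Poly_Mapping.keys f \<subseteq> A"
  shows "lin_ext scale g f = (\<Sum>a\<in>A. scale (Poly_Mapping.lookup f a) (g a))"
  unfolding lin_ext_def by (rule sum.mono_neutral_left) (use assms in \<open>auto simp: in_keys_iff\<close>)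

lemma lin_ext_add: "lin_ext scale g (f + f') = lin_ext scale g f + lin_ext scale g f'"
proof -
  let ?A = "Poly_Mapping.keys f \<union> Poly_Mapping.keys f'"
  have "lin_ext scale g (f + f') = (\<Sum>a\<in>?A. scale (Poly_Mapping.lookup (f + f') a) (g a))"
    by (rule lin_ext_superset) (use Poly_Mapping.keys_add[of f f'] in auto)
  also have "\<dots> = lin_ext scale g f + lin_ext scale g f'"
    by (simp add: lin_ext_superset[of ?A] lookup_add scale_left_distrib sum.distrib)
  finally show ?thesis .
qed

lemma lin_ext_zero [simp]: "lin_ext scale g 0 = 0"
  by (simp add: lin_ext_def)

lemma lin_ext_pscale: "lin_ext scale g (pscale c f) = scale c (lin_ext scale g f)"
proof -
  have "lin_ext scale g (pscale c f)
      = (\<Sum>a\<in>Poly_Mapping.keys f. scale (Poly_Mapping.lookup (pscale c f) a) (g a))"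
    by (rule lin_ext_superset) (use keys_pscale[of c f] in auto)
  then show ?thesis
    by (simp add: lin_ext_def scale_sum_right)
qed

lemma lin_ext_single: "lin_ext scale g (Poly_Mapping.single a c) = scale c (g a)"
  by (simp add: lin_ext_superset[of "{a}"])

lemma lin_ext_diff: "lin_ext scale g (f - f') = lin_ext scale g f - lin_ext scale g f'"
  using lin_ext_add[of g "f - f'" f'] by (simp add: algebra_simps)

text \<open>Linearity in the values on the basis, here and in the next lemmas, is what makes a
  nested \<open>lin_ext\<close> bilinear: the inner extension over the second variable is the basis
  value of the outer one.\<close>

lemma lin_ext_add_fun: "lin_ext scale (\<lambda>a. g a + h a) f = lin_ext scale g f + lin_ext scale h f"
  by (simp add: lin_ext_def scale_right_distrib sum.distrib)

lemma lin_ext_diff_fun: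
  "lin_ext scale (\<lambda>a. g a - h a) f = lin_ext scale g f - lin_ext scale h f"
  by (simp add: lin_ext_def scale_right_diff_distrib sum_subtractf)

lemma lin_ext_scale_fun: "lin_ext scale (\<lambda>a. scale c (g a)) f = scale c (lin_ext scale g f)"
  by (simp add: lin_ext_def scale_sum_right mult.commute)

lemma lin_ext_zero_fun [simp]: "lin_ext scale (\<lambda>a. 0) f = 0"
  by (simp add: lin_ext_def)

end

lemma lin_ext_cong:
  "(\<And>a. a \<in> Poly_Mapping.keys f \<Longrightarrow> g a = h a) \<Longrightarrow> lin_ext sc g f = lin_ext sc h f"
  by (simp add: lin_ext_def)

lemma lin_ext_in_submodule:
  fixes f :: "'x \<Rightarrow>\<^sub>0 'k::field" and g :: "'x \<Rightarrow> 'y \<Rightarrow>\<^sub>0 'k"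
  assumes N: "submodule N scalars (free_space S)"
    and g: "\<And>a. a \<in> Poly_Mapping.keys f \<Longrightarrow> g a \<in> N"
  shows "lin_ext pscale g f \<in> N"
proof -
  note E = module.submoduleE[OF module_free_space N]
  have 0: "0 \<in> N"
    using subgroup.one_closed[OF submodule.axioms(1)[OF N]] by simp
  have "(\<Sum>a\<in>A. pscale (Poly_Mapping.lookup f a) (g a)) \<in> N"
    if "finite A" "A \<subseteq> Poly_Mapping.keys f" for A
    using that
  proof induction
    case (insert a A)
    then show ?case
      using E(5)[of "pscale (Poly_Mapping.lookup f a) (g a)"]
        E(4)[of "Poly_Mapping.lookup f a" "g a"] g by simp
  qed (use 0 in simp)
  then show ?thesis
    by (simp add: lin_ext_def)
qed

lemma lin_ext_in_free_space:
  fixes f :: "'x \<Rightarrow>\<^sub>0 'k::field" and g :: "'x \<Rightarrow> 'y \<Rightarrow>\<^sub>0 'k"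
  assumes "\<And>a. a \<in> Poly_Mapping.keys f \<Longrightarrow> Poly_Mapping.keys (g a) \<subseteq> S"
  shows "Poly_Mapping.keys (lin_ext pscale g f) \<subseteq> S"
  using lin_ext_in_submodule[OF module.carrier_is_submodule[OF module_free_space], of f g S] assms
  by simp

section \<open>The central extension of the lattice\<close>

lemma add_grp_simps [simp]:
  "carrier add_grp = UNIV" "x \<otimes>\<^bsub>add_grp\<^esub> y = x + y" "\<one>\<^bsub>add_grp\<^esub> = 0"
  by (simp_all add: add_grp_def)

lemma comm_group_add_grp: "comm_group (add_grp :: 'l::ab_group_add monoid)"
proof (rule comm_groupI)
  show "\<exists>y\<in>carrier add_grp. y \<otimes>\<^bsub>add_grp\<^esub> x = \<one>\<^bsub>add_grp\<^esub>" for x :: 'l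
    by (auto intro!: exI[of _ "- x"])
qed (auto simp: algebra_simps)

lemma inv_add_grp [simp]: "inv\<^bsub>add_grp\<^esub> x = - x"
  by (rule group.inv_equality) (auto intro: comm_group.axioms(2) comm_group_add_grp)

section \<open>Coinvariants as a quotient group\<close>

lemma normal_coinv_ker:
  assumes "additive w"
  shows "coinv_ker w \<lhd> add_grp"
proof -
  interpret additive w by fact
  have "subgroup (coinv_ker w) add_grp"
  proof (rule group.subgroupI)
    show "group (add_grp :: 'a monoid)"
      using comm_group_add_grp by (rule comm_group.axioms(2))
    show "inv\<^bsub>add_grp\<^esub> a \<in> coinv_ker w" if "a \<in> coinv_ker w" for a
    proof -
      from that obtain x where "a = x - w x" by (auto simp: coinv_ker_def)
      then have "- a = (- x) - w (- x)" by (simp add: minus)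
      then show ?thesis unfolding coinv_ker_def by auto
    qed
    show "a \<otimes>\<^bsub>add_grp\<^esub> b \<in> coinv_ker w" if "a \<in> coinv_ker w" "b \<in> coinv_ker w" for a b
    proof -
      from that obtain x y where "a = x - w x" "b = y - w y" by (auto simp: coinv_ker_def)
      then have "a + b = (x + y) - w (x + y)" by (simp add: add)
      then show ?thesis unfolding coinv_ker_def by auto
    qed
  qed (auto simp: coinv_ker_def)
  then show ?thesis
    by (rule comm_group.subgroup_imp_normal[OF comm_group_add_grp])
qed

lemma
  assumes "additive w"
  shows coinv_class_eq_iff: "coinv_class w x = coinv_class w y \<longleftrightarrow> x - y \<in> coinv_ker w"
    and coinv_class_add: "coinv_class w x \<otimes>\<^bsub>coinv w\<^esub> coinv_class w y = coinv_class w (x + y)"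
    and coinv_class_zero: "coinv_class w 0 = \<one>\<^bsub>coinv w\<^esub>"
    and carrier_coinv: "carrier (coinv w) = range (coinv_class w)"
proof -
  interpret normal "coinv_ker w" add_grp
    by (rule normal_coinv_ker[OF assms])
  have grp: "group (add_grp :: 'a monoid)" and sub: "subgroup (coinv_ker w) add_grp"
    by (rule group_axioms, rule subgroup_axioms)
  have *: "a \<in> coinv_class w b \<longleftrightarrow> a - b \<in> coinv_ker w" for a b
    using rcos_module[OF grp, of b a] by (simp add: coinv_class_def)
  have "0 \<in> coinv_ker w"
    using subgroup.one_closed[OF sub] by simp
  then have "a \<in> coinv_class w a" for a
    by (simp add: *)
  then show "coinv_class w x = coinv_class w y \<longleftrightarrow> x - y \<in> coinv_ker w"
    using repr_independence[OF _ _ sub, of x y] unfolding *[symmetric]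
    by (fold coinv_class_def) (metis add_grp_simps(1) UNIV_I)
  show "coinv_class w x \<otimes>\<^bsub>coinv w\<^esub> coinv_class w y = coinv_class w (x + y)"
    using rcos_sum[of x y] by (simp add: coinv_class_def coinv_def FactGroup_def)
  show "coinv_class w 0 = \<one>\<^bsub>coinv w\<^esub>"
    using coset_mult_one[of "coinv_ker w"] by (simp add: coinv_class_def coinv_def FactGroup_def)
  show "carrier (coinv w) = range (coinv_class w)"
    by (simp add: coinv_class_def[abs_def] coinv_def FactGroup_def RCOSETS_def full_SetCompr_eq UNION_singleton_eq_range)
qed

lemma mu_simps [simp]:
  "c \<otimes>\<^bsub>mu \<zeta>\<^esub> d = c * d" "\<one>\<^bsub>mu \<zeta>\<^esub> = 1"
  by (simp_all add: mu_def)

lemma zeta_in_mu: "\<zeta> \<in> carrier (mu \<zeta>)"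
  unfolding mu_def using range_eqI[of \<zeta> "\<lambda>i. \<zeta> ^ i" 1] by simp

lemma lat_ext_mult: "a \<otimes>\<^bsub>lat_ext D\<^esub> b = (fst a + fst b, snd a \<otimes>\<^bsub>ext D\<^esub> snd b)"
  by (simp add: lat_ext_def DirProd_def split: prod.splits)

lemma fst_lat_emb [simp]: "fst (lat_emb D c) = 0"
  by (simp add: lat_emb_def)

lemma carrier_lat_ext_iff:
  "a \<in> carrier (lat_ext D) \<longleftrightarrow> snd a \<in> carrier (ext D) \<and> coinv_class (laut D) (fst a) = proj D (snd a)"
  by (auto simp: lat_ext_def)

locale lie_datum =
  fixes \<zeta> :: "'k::field_char_0" and D :: "('l::ab_group_add, 'h, 'k) datum"
  assumes input: "input_datum \<zeta> D"
begin

lemma lattice: "is_lattice (lform D)" and generate_roots: "generate add_grp (roots (lform D)) = UNIV"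
  using input by (simp_all add: input_datum_def simply_laced_root_lattice_def)

lemma lform_commute: "lform D x y = lform D y x"
  and lform_add_left: "lform D (x + y) z = lform D x z + lform D y z"
  and lform_pos: "x \<noteq> 0 \<Longrightarrow> lform D x x > 0"
  using lattice unfolding is_lattice_def by blast+

lemma lform_add_right: "lform D x (y + z) = lform D x y + lform D x z"
  using lform_add_left lform_commute by metis

lemma additive_lform: "additive (lform D x)" "additive (\<lambda>x. lform D x y)"
  by (rule additive.intro, rule lform_add_right, rule additive.intro, rule lform_add_left)

lemma additive_laut: "additive (laut D)"
  using input by (auto intro!: additive.intro simp: input_datum_def lattice_iso_def iso_def hom_def)

lemma central_ext: "central_extension (mu \<zeta>) (ext D) (coinv (laut D)) (emb D) (proj D)"
  using input by (simp add: input_datum_def)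

sublocale ext: group "ext D"
  using central_ext by (simp add: central_extension_def)

lemma emb_hom: "emb D \<in> hom (mu \<zeta>) (ext D)"
  and proj_hom: "proj D \<in> hom (ext D) (coinv (laut D))"
  using central_ext unfolding central_extension_def by blast+

lemma emb_closed [simp]: "c \<in> carrier (mu \<zeta>) \<Longrightarrow> emb D c \<in> carrier (ext D)"
  using emb_hom by (rule hom_in_carrier)

lemma emb_mult:
  "\<lbrakk>c \<in> carrier (mu \<zeta>); d \<in> carrier (mu \<zeta>)\<rbrakk> \<Longrightarrow> emb D (c * d) = emb D c \<otimes>\<^bsub>ext D\<^esub> emb D d"
  using hom_mult[OF emb_hom] by simp

lemma emb_inj: "\<lbrakk>c \<in> carrier (mu \<zeta>); d \<in> carrier (mu \<zeta>); emb D c = emb D d\<rbrakk> \<Longrightarrow> c = d"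
  using central_ext by (auto simp: central_extension_def inj_on_def)

lemma emb_central:
  "\<lbrakk>c \<in> carrier (mu \<zeta>); h \<in> carrier (ext D)\<rbrakk> \<Longrightarrow> h \<otimes>\<^bsub>ext D\<^esub> emb D c = emb D c \<otimes>\<^bsub>ext D\<^esub> h"
  using central_ext by (auto simp: central_extension_def)

lemma emb_image: "emb D ` carrier (mu \<zeta>) = kernel (ext D) (coinv (laut D)) (proj D)"
  using central_ext by (simp add: central_extension_def)

lemma proj_mult:
  "\<lbrakk>g \<in> carrier (ext D); h \<in> carrier (ext D)\<rbrakk> \<Longrightarrow>
    proj D (g \<otimes>\<^bsub>ext D\<^esub> h) = proj D g \<otimes>\<^bsub>coinv (laut D)\<^esub> proj D h"
  by (rule hom_mult[OF proj_hom])

lemma proj_is_class: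
  assumes "h \<in> carrier (ext D)"
  obtains x where "proj D h = coinv_class (laut D) x"
  using hom_in_carrier[OF proj_hom assms] unfolding carrier_coinv[OF additive_laut] by blast

lemma proj_emb: "c \<in> carrier (mu \<zeta>) \<Longrightarrow> proj D (emb D c) = coinv_class (laut D) 0"
  using emb_image coinv_class_zero[OF additive_laut] by (auto simp: kernel_def)

lemma lat_ext_closed [simp]:
  "\<lbrakk>a \<in> carrier (lat_ext D); b \<in> carrier (lat_ext D)\<rbrakk> \<Longrightarrow> a \<otimes>\<^bsub>lat_ext D\<^esub> b \<in> carrier (lat_ext D)"
  by (auto simp: carrier_lat_ext_iff lat_ext_mult proj_mult coinv_class_add[OF additive_laut, symmetric])

lemma lat_emb_closed [simp]: "c \<in> carrier (mu \<zeta>) \<Longrightarrow> lat_emb D c \<in> carrier (lat_ext D)"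
  by (simp add: carrier_lat_ext_iff lat_emb_def proj_emb)

lemma lat_ext_assoc:
  "\<lbrakk>a \<in> carrier (lat_ext D); b \<in> carrier (lat_ext D); c \<in> carrier (lat_ext D)\<rbrakk> \<Longrightarrow>
    a \<otimes>\<^bsub>lat_ext D\<^esub> b \<otimes>\<^bsub>lat_ext D\<^esub> c = a \<otimes>\<^bsub>lat_ext D\<^esub> (b \<otimes>\<^bsub>lat_ext D\<^esub> c)"
  by (simp add: carrier_lat_ext_iff lat_ext_mult ext.m_assoc add.assoc)

lemma lat_emb_central:
  "\<lbrakk>c \<in> carrier (mu \<zeta>); a \<in> carrier (lat_ext D)\<rbrakk> \<Longrightarrow>
    a \<otimes>\<^bsub>lat_ext D\<^esub> lat_emb D c = lat_emb D c \<otimes>\<^bsub>lat_ext D\<^esub> a"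
  by (simp add: carrier_lat_ext_iff lat_ext_mult lat_emb_def emb_central)

lemma central_scalar_lat_emb: "c \<in> carrier (mu \<zeta>) \<Longrightarrow> central_scalar \<zeta> D (lat_emb D c) = c"
  unfolding central_scalar_def by (rule the_equality) (auto simp: lat_emb_def dest: emb_inj)

text \<open>Over \<open>0\<close> the second component lies in the kernel of \<open>proj D\<close>,
  and exactness of the extension identifies this kernel with the image of
  \<open>emb D\<close>.\<close>

lemma obtain_central_scalar:
  assumes "a \<in> carrier (lat_ext D)" and "fst a = 0"
  obtains c where "c \<in> carrier (mu \<zeta>)" and "a = lat_emb D c"
proof -
  have "snd a \<in> kernel (ext D) (coinv (laut D)) (proj D)"
    using assms coinv_class_zero[OF additive_laut] by (simp add: carrier_lat_ext_iff kernel_def)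
  then obtain c where "c \<in> carrier (mu \<zeta>)" "snd a = emb D c"
    unfolding emb_image[symmetric] by blast
  then show thesis
    using that assms(2) by (simp add: lat_emb_def prod_eq_iff)
qed

lemma mu_mult_closed: "\<lbrakk>c \<in> carrier (mu \<zeta>); d \<in> carrier (mu \<zeta>)\<rbrakk> \<Longrightarrow> c * d \<in> carrier (mu \<zeta>)"
  by (auto simp: mu_def simp flip: power_add)

text \<open>This homogeneity makes the bracket of opposite roots, a scalar times a coroot,
  compatible with the relation \<open>X_{\<zeta>a} = \<zeta> X_a\<close>.\<close>

lemma central_scalar_zeta_mult:
  assumes "a \<in> carrier (lat_ext D)" and "fst a = 0"
  shows "central_scalar \<zeta> D (lat_emb D \<zeta> \<otimes>\<^bsub>lat_ext D\<^esub> a) = \<zeta> * central_scalar \<zeta> D a"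
proof -
  obtain c where c: "c \<in> carrier (mu \<zeta>)" "a = lat_emb D c"
    using obtain_central_scalar[OF assms] .
  then have "lat_emb D \<zeta> \<otimes>\<^bsub>lat_ext D\<^esub> a = lat_emb D (\<zeta> * c)"
    using zeta_in_mu[of \<zeta>] by (simp add: lat_emb_def lat_ext_mult emb_mult)
  then show ?thesis
    using c central_scalar_lat_emb mu_mult_closed[OF zeta_in_mu] by simp
qed

lemma ext_roots_carrier: "a \<in> ext_roots D \<Longrightarrow> a \<in> carrier (lat_ext D)"
  by (simp add: ext_roots_def)

lemma zeta_mult_ext_roots: "a \<in> ext_roots D \<Longrightarrow> lat_emb D \<zeta> \<otimes>\<^bsub>lat_ext D\<^esub> a \<in> ext_roots D"
  using zeta_in_mu[of \<zeta>] by (simp add: ext_roots_def) (simp add: lat_ext_mult lat_emb_def)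

lemma fst_lat_ext_mult [simp]: "fst (a \<otimes>\<^bsub>lat_ext D\<^esub> b) = fst a + fst b"
  by (simp add: lat_ext_mult)

lemma zeta_mult_left:
  "\<lbrakk>a \<in> carrier (lat_ext D); b \<in> carrier (lat_ext D)\<rbrakk> \<Longrightarrow>
    lat_emb D \<zeta> \<otimes>\<^bsub>lat_ext D\<^esub> a \<otimes>\<^bsub>lat_ext D\<^esub> b = lat_emb D \<zeta> \<otimes>\<^bsub>lat_ext D\<^esub> (a \<otimes>\<^bsub>lat_ext D\<^esub> b)"
  by (simp add: lat_ext_assoc zeta_in_mu)

text \<open>Centrality moves the lift of \<open>\<zeta>\<close> past \<open>a\<close>, so the second
  factor obeys the same rule as the first.\<close>

lemma zeta_mult_right:
  "\<lbrakk>a \<in> carrier (lat_ext D); b \<in> carrier (lat_ext D)\<rbrakk> \<Longrightarrow>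
    a \<otimes>\<^bsub>lat_ext D\<^esub> (lat_emb D \<zeta> \<otimes>\<^bsub>lat_ext D\<^esub> b) = lat_emb D \<zeta> \<otimes>\<^bsub>lat_ext D\<^esub> (a \<otimes>\<^bsub>lat_ext D\<^esub> b)"
  by (metis lat_ext_assoc lat_emb_central lat_emb_closed zeta_in_mu)

end

section \<open>The bracket\<close>

lemma t_space_simps [simp]:
  "s \<in> carrier t_space \<longleftrightarrow> (\<forall>x y. s (x + y) = s x + s y)"
  "s \<oplus>\<^bsub>t_space\<^esub> s' = (\<lambda>x. s x + s' x)"
  "\<zero>\<^bsub>t_space\<^esub> = (\<lambda>_. 0)"
  "c \<odot>\<^bsub>t_space\<^esub> s = (\<lambda>x. c * s x)"
  by (simp_all add: t_space_def)

lemma h_lie_simps [simp]: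
  "carrier (h_lie \<zeta> D) = carrier (h_space \<zeta> D)"
  "x \<oplus>\<^bsub>h_lie \<zeta> D\<^esub> y = x \<oplus>\<^bsub>h_space \<zeta> D\<^esub> y"
  "\<zero>\<^bsub>h_lie \<zeta> D\<^esub> = \<zero>\<^bsub>h_space \<zeta> D\<^esub>"
  "c \<odot>\<^bsub>h_lie \<zeta> D\<^esub> x = c \<odot>\<^bsub>h_space \<zeta> D\<^esub> x"
  by (simp_all add: h_lie_def)

lemma linear_maps_h_lie: "linear_maps (h_lie \<zeta> D) (h_lie \<zeta> D') = linear_maps (h_space \<zeta> D) (h_space \<zeta> D')"
  by (simp add: linear_maps_def)

text \<open>The adjoint action of the torus, written for every functional \<open>s\<close> and not
  only for coroots: \<open>X_b\<close> is an eigenvector with eigenvalue \<open>s (fst b)\<close>,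
  which is \<open>(\<alpha>, \<beta>)\<close> when \<open>s\<close> is the coroot of
  \<open>\<alpha>\<close> and \<open>b\<close> lies over \<open>\<beta>\<close>.\<close>

definition action :: "('l \<Rightarrow> 'k::field) \<Rightarrow> ('l \<times> 'h \<Rightarrow>\<^sub>0 'k) \<Rightarrow> ('l \<times> 'h \<Rightarrow>\<^sub>0 'k)" where
  "action s = lin_ext pscale (\<lambda>b. Poly_Mapping.single b (s (fst b)))"

lemma action_add: "action s (f + g) = action s f + action s g"
  unfolding action_def by (rule vector_space.lin_ext_add[OF vector_space_pscale])

lemma action_pscale: "action s (pscale c f) = pscale c (action s f)"
  unfolding action_def by (rule vector_space.lin_ext_pscale[OF vector_space_pscale])

lemma action_zero: "action s 0 = 0"
  unfolding action_def by (rule vector_space.lin_ext_zero[OF vector_space_pscale])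

lemma action_single: "action s (Poly_Mapping.single b c) = Poly_Mapping.single b (c * s (fst b))"
  by (simp add: action_def vector_space.lin_ext_single[OF vector_space_pscale])

lemma action_add_fun: "action (\<lambda>x. s x + s' x) f = action s f + action s' f"
  by (simp add: action_def single_add vector_space.lin_ext_add_fun[OF vector_space_pscale])

lemma action_scale_fun: "action (\<lambda>x. c * s x) f = pscale c (action s f)"
  unfolding action_def
  using vector_space.lin_ext_scale_fun[OF vector_space_pscale, of c "\<lambda>b. Poly_Mapping.single b (s (fst b))" f]
  by simp

lemma action_zero_fun: "action (\<lambda>x. 0) f = 0"
  by (simp add: action_def vector_space.lin_ext_zero_fun[OF vector_space_pscale])

lemma action_closed: "Poly_Mapping.keys f \<subseteq> S \<Longrightarrow> Poly_Mapping.keys (action s f) \<subseteq> S"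
  unfolding action_def by (rule lin_ext_in_free_space) auto

context lie_datum
begin

section \<open>The relations of the root part and maps that respect them\<close>

abbreviation rels :: "('l \<times> 'h \<Rightarrow>\<^sub>0 'k) set" where
  "rels \<equiv> l_relations \<zeta> D"

abbreviation lcls :: "('l \<times> 'h \<Rightarrow>\<^sub>0 'k) \<Rightarrow> ('l \<times> 'h \<Rightarrow>\<^sub>0 'k) set" where
  "lcls f \<equiv> l_relations \<zeta> D +>\<^bsub>free_space (ext_roots D)\<^esub> f"

abbreviation zmult :: "'l \<times> 'h \<Rightarrow> 'l \<times> 'h" where
  "zmult a \<equiv> lat_emb D \<zeta> \<otimes>\<^bsub>lat_ext D\<^esub> a"

lemma l_generators_closed:
  "{Poly_Mapping.single (zmult a) 1 - Poly_Mapping.single a \<zeta> |a. a \<in> ext_roots D}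
    \<subseteq> carrier (free_space (ext_roots D))"
  using zeta_mult_ext_roots by (auto dest!: subsetD[OF keys_diff] split: if_splits)

lemma submodule_rels: "submodule rels scalars (free_space (ext_roots D))"
  unfolding l_relations_def by (rule submodule_span_in[OF module_free_space l_generators_closed])

text \<open>The factor \<open>c\<close> makes room for the coefficients that multiply a generator
  later: values of \<open>eps\<close> in the bracket and eigenvalues in
  \<open>action\<close>.\<close>

lemma rels_generator:
  "a \<in> ext_roots D \<Longrightarrow> Poly_Mapping.single (zmult a) c - Poly_Mapping.single a (\<zeta> * c) \<in> rels"
proof -
  assume "a \<in> ext_roots D"
  then have "Poly_Mapping.single (zmult a) 1 - Poly_Mapping.single a \<zeta> \<in> rels"
    unfolding l_relations_def by (intro subsetD[OF span_in_superset] CollectI exI[of _ a]) simp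
  then have "pscale c (Poly_Mapping.single (zmult a) 1 - Poly_Mapping.single a \<zeta>) \<in> rels"
    using module.submoduleE(4)[OF module_free_space submodule_rels, of c] by simp
  then show ?thesis
    by (simp add: pscale_diff mult.commute)
qed

lemma rels_closed:
  "f \<in> rels \<Longrightarrow> Poly_Mapping.keys f \<subseteq> ext_roots D"
  "0 \<in> rels"
  "\<lbrakk>f \<in> rels; g \<in> rels\<rbrakk> \<Longrightarrow> f + g \<in> rels"
  "f \<in> rels \<Longrightarrow> pscale c f \<in> rels"
  "\<lbrakk>f \<in> rels; g \<in> rels\<rbrakk> \<Longrightarrow> f - g \<in> rels"
proof -
  note E = module.submoduleE[OF module_free_space submodule_rels]
  show "f \<in> rels \<Longrightarrow> Poly_Mapping.keys f \<subseteq> ext_roots D"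
    using E(1) unfolding subset_iff free_space_simps by blast
  show "0 \<in> rels"
    using subgroup.one_closed[OF submodule.axioms(1)[OF submodule_rels]] by simp
  show add: "\<lbrakk>f \<in> rels; g \<in> rels\<rbrakk> \<Longrightarrow> f + g \<in> rels" for f g
    using E(5)[of f g] by simp
  show scale: "f \<in> rels \<Longrightarrow> pscale c f \<in> rels" for f c
    using E(4)[of c f] by simp
  have "f - g = f + pscale (-1) g" for f g :: "'l \<times> 'h \<Rightarrow>\<^sub>0 'k"
    by (rule poly_mapping_eqI) (simp add: lookup_add lookup_minus)
  then show "\<lbrakk>f \<in> rels; g \<in> rels\<rbrakk> \<Longrightarrow> f - g \<in> rels"
    using add scale by metis
qed

lemma rels_induct [consumes 1, case_names zero base add smult]:
  assumes "f \<in> rels" and "P 0"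
    and "\<And>a. a \<in> ext_roots D \<Longrightarrow> P (Poly_Mapping.single (zmult a) 1 - Poly_Mapping.single a \<zeta>)"
    and "\<And>f g. \<lbrakk>P f; P g\<rbrakk> \<Longrightarrow> P (f + g)"
    and "\<And>c f. P f \<Longrightarrow> P (pscale c f)"
  shows "P f"
  using module_free_space l_generators_closed assms(1)[unfolded l_relations_def]
  by (induction rule: span_in_induct) (use assms(2-) in auto)

text \<open>By linearity only the generators of \<open>rels\<close> matter, and on the generator at
  \<open>a\<close> the extension takes exactly the value in the second assumption.\<close>

lemma lin_ext_rels:
  fixes g :: "'l \<times> 'h \<Rightarrow> 'l \<times> 'h \<Rightarrow>\<^sub>0 'k"
  assumes f: "f \<in> rels"
    and g: "\<And>a. a \<in> ext_roots D \<Longrightarrow> g (zmult a) - pscale \<zeta> (g a) \<in> rels"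
  shows "lin_ext pscale g f \<in> rels"
proof -
  interpret vector_space "pscale :: 'k \<Rightarrow> ('l \<times> 'h \<Rightarrow>\<^sub>0 'k) \<Rightarrow> _"
    by (rule vector_space_pscale)
  from f show ?thesis
    by (induction rule: rels_induct)
      (simp_all add: lin_ext_add lin_ext_pscale lin_ext_diff lin_ext_single rels_closed g)
qed

lemma lin_ext_rels_eq_0:
  fixes g :: "'l \<times> 'h \<Rightarrow> 'k"
  assumes f: "f \<in> rels" and g: "\<And>a. a \<in> ext_roots D \<Longrightarrow> g (zmult a) = \<zeta> * g a"
  shows "lin_ext (*) g f = 0"
proof -
  interpret vector_space "(*) :: 'k \<Rightarrow> 'k \<Rightarrow> 'k"
    by (rule vector_space_times)
  from f show ?thesis
    by (induction rule: rels_induct)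
      (simp_all add: lin_ext_add lin_ext_pscale lin_ext_diff lin_ext_single g)
qed

lemma carrier_l_space: "carrier (l_space \<zeta> D) = lcls ` {f. Poly_Mapping.keys f \<subseteq> ext_roots D}"
  unfolding l_space_def using carrier_quotient[OF module_free_space submodule_rels]
  by (simp add: free_space_def)

lemma lcls_simps:
  "\<lbrakk>Poly_Mapping.keys f \<subseteq> ext_roots D; Poly_Mapping.keys g \<subseteq> ext_roots D\<rbrakk> \<Longrightarrow>
    lcls f \<oplus>\<^bsub>l_space \<zeta> D\<^esub> lcls g = lcls (f + g)"
  "Poly_Mapping.keys f \<subseteq> ext_roots D \<Longrightarrow> c \<odot>\<^bsub>l_space \<zeta> D\<^esub> lcls f = lcls (pscale c f)"
  "\<zero>\<^bsub>l_space \<zeta> D\<^esub> = lcls 0"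
  unfolding l_space_def
  using quotient_add[OF module_free_space submodule_rels] quotient_smult[OF module_free_space submodule_rels]
    quotient_zero[OF module_free_space submodule_rels]
  by auto

lemma lcls_eq_iff:
  "\<lbrakk>Poly_Mapping.keys f \<subseteq> ext_roots D; Poly_Mapping.keys g \<subseteq> ext_roots D\<rbrakk> \<Longrightarrow>
    lcls f = lcls g \<longleftrightarrow> f - g \<in> rels"
  using quotient_eq_iff[OF module_free_space submodule_rels, of f g]
    minus_free_space[of f "ext_roots D" g] by simp

lemma module_l_space: "module scalars (l_space \<zeta> D)"
  unfolding l_space_def by (rule module_quotient_space[OF module_free_space submodule_rels])

lemma module_h_space: "module scalars (h_space \<zeta> D)"
  unfolding h_space_def by (rule module_direct_sum[OF module_t_space module_l_space])

lemma carrier_h_space: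
  "(s, A) \<in> carrier (h_space \<zeta> D) \<longleftrightarrow> s \<in> carrier t_space \<and> A \<in> carrier (l_space \<zeta> D)"
  by (simp add: h_space_def direct_sum_simps del: t_space_simps)

lemma h_space_cases:
  assumes "x \<in> carrier (h_space \<zeta> D)"
  obtains s f where "x = (s, lcls f)" "s \<in> carrier t_space" "Poly_Mapping.keys f \<subseteq> ext_roots D"
  using assms by (cases x) (auto simp: carrier_h_space carrier_l_space simp del: t_space_simps)

text \<open>The structure constants are split by the summand that receives the value: here the part
  in the free space over the roots, and in \<open>torus_coeff\<close> the functional for opposite
  roots.\<close>

definition root_coeff :: "'l \<times> 'h \<Rightarrow> 'l \<times> 'h \<Rightarrow> ('l \<times> 'h \<Rightarrow>\<^sub>0 'k)" where
  "root_coeff a b = (if fst a + fst b \<noteq> 0 \<and> fst a + fst b \<in> roots (lform D)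
     then Poly_Mapping.single (a \<otimes>\<^bsub>lat_ext D\<^esub> b) (eps D (fst a) (fst b)) else 0)"

text \<open>The functional is evaluated at a lattice point \<open>x\<close>, so that the bilinear
  extension takes place in the field, one \<open>x\<close> at a time.\<close>

definition torus_coeff :: "'l \<Rightarrow> 'l \<times> 'h \<Rightarrow> 'l \<times> 'h \<Rightarrow> 'k" where
  "torus_coeff x a b = (if fst a + fst b = 0
     then eps D (fst a) (fst b) * central_scalar \<zeta> D (a \<otimes>\<^bsub>lat_ext D\<^esub> b) * of_int (lform D (fst a) x)
     else 0)"

definition root_part :: "('l \<times> 'h \<Rightarrow>\<^sub>0 'k) \<Rightarrow> ('l \<times> 'h \<Rightarrow>\<^sub>0 'k) \<Rightarrow> ('l \<times> 'h \<Rightarrow>\<^sub>0 'k)" where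
  "root_part f g = lin_ext pscale (\<lambda>a. lin_ext pscale (root_coeff a) g) f"

definition torus_part :: "('l \<times> 'h \<Rightarrow>\<^sub>0 'k) \<Rightarrow> ('l \<times> 'h \<Rightarrow>\<^sub>0 'k) \<Rightarrow> 'l \<Rightarrow> 'k" where
  "torus_part f g x = lin_ext (*) (\<lambda>a. lin_ext (*) (torus_coeff x a) g) f"

lemma root_coeff_closed:
  "\<lbrakk>a \<in> ext_roots D; b \<in> ext_roots D\<rbrakk> \<Longrightarrow> Poly_Mapping.keys (root_coeff a b) \<subseteq> ext_roots D"
  by (auto simp: root_coeff_def ext_roots_def)

text \<open>Multiplication by \<open>\<zeta>\<close> does not change \<open>fst\<close>, so the case
  and the value of \<open>eps\<close> are the same on both sides. Centrality then turns either
  difference into a multiple of the generator of \<open>rels\<close> at the product of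
  \<open>a\<close> and \<open>b\<close>.\<close>

lemma root_coeff_zeta:
  assumes "a \<in> ext_roots D" and "b \<in> ext_roots D"
  shows "root_coeff (zmult a) b - pscale \<zeta> (root_coeff a b) \<in> rels"
    and "root_coeff a (zmult b) - pscale \<zeta> (root_coeff a b) \<in> rels"
proof -
  have ab: "a \<otimes>\<^bsub>lat_ext D\<^esub> b \<in> ext_roots D" if "fst a + fst b \<in> roots (lform D)"
    using that assms by (simp add: ext_roots_def)
  then show "root_coeff (zmult a) b - pscale \<zeta> (root_coeff a b) \<in> rels"
    "root_coeff a (zmult b) - pscale \<zeta> (root_coeff a b) \<in> rels"
    using rels_generator[OF ab, of "eps D (fst a) (fst b)"]
    by (simp_all add: root_coeff_def zeta_mult_left zeta_mult_right assms
        ext_roots_carrier rels_closed mult.commute)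
qed

lemma torus_coeff_zeta:
  assumes "a \<in> ext_roots D" and "b \<in> ext_roots D"
  shows "torus_coeff x (zmult a) b = \<zeta> * torus_coeff x a b"
    and "torus_coeff x a (zmult b) = \<zeta> * torus_coeff x a b"
  using assms
  by (simp_all add: torus_coeff_def zeta_mult_left zeta_mult_right
      ext_roots_carrier central_scalar_zeta_mult)

lemma action_rels: "f \<in> rels \<Longrightarrow> action s f \<in> rels"
  unfolding action_def
  by (rule lin_ext_rels, assumption) (simp add: rels_generator)

lemma root_part_closed:
  "\<lbrakk>Poly_Mapping.keys f \<subseteq> ext_roots D; Poly_Mapping.keys g \<subseteq> ext_roots D\<rbrakk> \<Longrightarrow>
    Poly_Mapping.keys (root_part f g) \<subseteq> ext_roots D"
  unfolding root_part_def
  by (intro lin_ext_in_free_space root_coeff_closed) (auto dest: subsetD)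

text \<open>In the first argument, the difference required at \<open>a\<close> is pulled inside the
  extension over \<open>b\<close>, where each value is a relation. In the second argument the inner
  extension is already a relation for every \<open>a\<close>, and the outer one only combines
  these.\<close>

lemma root_part_rels:
  "\<lbrakk>f \<in> rels; Poly_Mapping.keys g \<subseteq> ext_roots D\<rbrakk> \<Longrightarrow> root_part f g \<in> rels"
  "\<lbrakk>g \<in> rels; Poly_Mapping.keys f \<subseteq> ext_roots D\<rbrakk> \<Longrightarrow> root_part f g \<in> rels"
proof -
  interpret vector_space "pscale :: 'k \<Rightarrow> ('l \<times> 'h \<Rightarrow>\<^sub>0 'k) \<Rightarrow> _"
    by (rule vector_space_pscale)
  show "root_part f g \<in> rels" if f: "f \<in> rels" and g: "Poly_Mapping.keys g \<subseteq> ext_roots D"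
    unfolding root_part_def
  proof (rule lin_ext_rels[OF f])
    fix a assume a: "a \<in> ext_roots D"
    have "lin_ext pscale (root_coeff (zmult a)) g - pscale \<zeta> (lin_ext pscale (root_coeff a) g)
        = lin_ext pscale (\<lambda>b. root_coeff (zmult a) b - pscale \<zeta> (root_coeff a b)) g"
      by (simp add: lin_ext_diff_fun lin_ext_scale_fun)
    also have "\<dots> \<in> rels"
      by (rule lin_ext_in_submodule[OF submodule_rels]) (use g a root_coeff_zeta(1) in blast)
    finally show "lin_ext pscale (root_coeff (zmult a)) g - pscale \<zeta> (lin_ext pscale (root_coeff a) g) \<in> rels" .
  qed
  show "root_part f g \<in> rels" if g: "g \<in> rels" and f: "Poly_Mapping.keys f \<subseteq> ext_roots D"
    unfolding root_part_def
    by (rule lin_ext_in_submodule[OF submodule_rels], rule lin_ext_rels[OF g], rule root_coeff_zeta(2))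
      (use f in auto)
qed

lemma torus_part_rels:
  "\<lbrakk>f \<in> rels; Poly_Mapping.keys g \<subseteq> ext_roots D\<rbrakk> \<Longrightarrow> torus_part f g x = 0"
  "\<lbrakk>g \<in> rels; Poly_Mapping.keys f \<subseteq> ext_roots D\<rbrakk> \<Longrightarrow> torus_part f g x = 0"
proof -
  interpret vector_space "(*) :: 'k \<Rightarrow> 'k \<Rightarrow> 'k"
    by (rule vector_space_times)
  show "torus_part f g x = 0" if f: "f \<in> rels" and g: "Poly_Mapping.keys g \<subseteq> ext_roots D"
    unfolding torus_part_def
  proof (rule lin_ext_rels_eq_0[OF f])
    fix a assume a: "a \<in> ext_roots D"
    have "lin_ext (*) (torus_coeff x (zmult a)) g = lin_ext (*) (\<lambda>b. \<zeta> * torus_coeff x a b) g"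
      by (rule lin_ext_cong) (use a g torus_coeff_zeta(1) in blast)
    then show "lin_ext (*) (torus_coeff x (zmult a)) g = \<zeta> * lin_ext (*) (torus_coeff x a) g"
      by (simp add: lin_ext_scale_fun)
  qed
  show "torus_part f g x = 0" if g: "g \<in> rels" and f: "Poly_Mapping.keys f \<subseteq> ext_roots D"
  proof -
    have "torus_part f g x = lin_ext (*) (\<lambda>a. 0) f"
      unfolding torus_part_def
      by (rule lin_ext_cong, rule lin_ext_rels_eq_0[OF g], rule torus_coeff_zeta(2)) (use f in auto)
    then show ?thesis
      by simp
  qed
qed

lemma root_part_linear:
  "root_part (f + f') g = root_part f g + root_part f' g"
  "root_part f (g + g') = root_part f g + root_part f g'"
  "root_part (pscale c f) g = pscale c (root_part f g)"
  "root_part f (pscale c g) = pscale c (root_part f g)"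
  "root_part 0 g = 0"
  "root_part f 0 = 0"
proof -
  interpret vector_space "pscale :: 'k \<Rightarrow> ('l \<times> 'h \<Rightarrow>\<^sub>0 'k) \<Rightarrow> _"
    by (rule vector_space_pscale)
  show "root_part (f + f') g = root_part f g + root_part f' g"
    "root_part f (g + g') = root_part f g + root_part f g'"
    "root_part (pscale c f) g = pscale c (root_part f g)"
    "root_part f (pscale c g) = pscale c (root_part f g)"
    "root_part 0 g = 0" "root_part f 0 = 0"
    by (simp_all add: root_part_def lin_ext_add lin_ext_add_fun lin_ext_pscale lin_ext_scale_fun)
qed

lemma torus_part_linear:
  "torus_part (f + f') g x = torus_part f g x + torus_part f' g x"
  "torus_part f (g + g') x = torus_part f g x + torus_part f g' x"
  "torus_part (pscale c f) g x = c * torus_part f g x"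
  "torus_part f (pscale c g) x = c * torus_part f g x"
  "torus_part 0 g x = 0"
  "torus_part f 0 x = 0"
proof -
  interpret vector_space "(*) :: 'k \<Rightarrow> 'k \<Rightarrow> 'k"
    by (rule vector_space_times)
  show "torus_part (f + f') g x = torus_part f g x + torus_part f' g x"
    "torus_part f (g + g') x = torus_part f g x + torus_part f g' x"
    "torus_part (pscale c f) g x = c * torus_part f g x"
    "torus_part f (pscale c g) x = c * torus_part f g x"
    "torus_part 0 g x = 0" "torus_part f 0 x = 0"
    by (simp_all add: torus_part_def lin_ext_add lin_ext_add_fun lin_ext_pscale lin_ext_scale_fun)
qed

text \<open>The point \<open>x\<close> enters \<open>torus_coeff\<close> only through the form,
  whose additivity passes through both extensions.\<close>

lemma torus_part_closed: "torus_part f g \<in> carrier t_space"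
proof -
  interpret vector_space "(*) :: 'k \<Rightarrow> 'k \<Rightarrow> 'k"
    by (rule vector_space_times)
  have "torus_coeff (x + y) a = (\<lambda>b. torus_coeff x a b + torus_coeff y a b)" for x y a
    unfolding torus_coeff_def by (rule ext) (simp only: lform_add_right of_int_add distrib_left split: if_splits, simp)
  then show ?thesis
    by (simp add: torus_part_def lin_ext_add_fun)
qed

lemma root_part_single:
  "root_part (Poly_Mapping.single a 1) (Poly_Mapping.single b 1) = root_coeff a b"
  by (simp add: root_part_def vector_space.lin_ext_single[OF vector_space_pscale])

lemma torus_part_single:
  "torus_part (Poly_Mapping.single a 1) (Poly_Mapping.single b 1) x = torus_coeff x a b"
  by (simp add: torus_part_def vector_space.lin_ext_single[OF vector_space_times])

text \<open>Maps out of the quotient are defined through a chosen representative; independence of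
  the choice then amounts to stability of \<open>rels\<close>, by \<open>lrep_lcls\<close>.\<close>

definition lrep :: "('l \<times> 'h \<Rightarrow>\<^sub>0 'k) set \<Rightarrow> ('l \<times> 'h \<Rightarrow>\<^sub>0 'k)" where
  "lrep A = (SOME f. Poly_Mapping.keys f \<subseteq> ext_roots D \<and> lcls f = A)"

text \<open>The expansion of \<open>[s + f, s' + g]\<close>, with \<open>s\<close>,
  \<open>s'\<close> in the torus and \<open>f\<close>, \<open>g\<close> in the root part:
  \<open>[s, s']\<close> vanishes, \<open>s\<close> acts on \<open>g\<close>, the term
  \<open>[f, s']\<close> is minus the action of \<open>s'\<close> on \<open>f\<close>, and
  \<open>[f, g]\<close> has a component in each summand.\<close>

definition bracket :: "('l, 'h, 'k) h_elem \<Rightarrow> ('l, 'h, 'k) h_elem \<Rightarrow> ('l, 'h, 'k) h_elem" where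
  "bracket x y = (torus_part (lrep (snd x)) (lrep (snd y)),
     lcls (action (fst x) (lrep (snd y)) - action (fst y) (lrep (snd x))
       + root_part (lrep (snd x)) (lrep (snd y))))"

lemma lrep_lcls:
  assumes "Poly_Mapping.keys f \<subseteq> ext_roots D"
  obtains n where "n \<in> rels" and "lrep (lcls f) = f + n"
proof -
  have "Poly_Mapping.keys (lrep (lcls f)) \<subseteq> ext_roots D \<and> lcls (lrep (lcls f)) = lcls f"
    unfolding lrep_def by (rule someI[of _ f]) (use assms in simp)
  then have "lrep (lcls f) - f \<in> rels"
    using lcls_eq_iff assms by blast
  then show thesis
    by (rule that) simp
qed

lemma bracket_root_part_closed:
  assumes "Poly_Mapping.keys f \<subseteq> ext_roots D" and "Poly_Mapping.keys g \<subseteq> ext_roots D"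
  shows "Poly_Mapping.keys (action s g - action s' f + root_part f g) \<subseteq> ext_roots D"
  using assms by (intro order_trans[OF Poly_Mapping.keys_add] order_trans[OF keys_diff] Un_least
      action_closed root_part_closed)

lemma bracket_lcls:
  assumes f: "Poly_Mapping.keys f \<subseteq> ext_roots D" and g: "Poly_Mapping.keys g \<subseteq> ext_roots D"
  shows "bracket (s, lcls f) (s', lcls g)
    = (torus_part f g, lcls (action s g - action s' f + root_part f g))"
proof -
  obtain m n where m: "m \<in> rels" "lrep (lcls f) = f + m" and n: "n \<in> rels" "lrep (lcls g) = g + n"
    using lrep_lcls[OF f] lrep_lcls[OF g] by metis
  have keys: "Poly_Mapping.keys m \<subseteq> ext_roots D" "Poly_Mapping.keys n \<subseteq> ext_roots D"
    using m n rels_closed(1) by blast+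
  \<comment> \<open>All terms of the expansion at \<open>f + m\<close> and \<open>g + n\<close> in
    which \<open>m\<close> or \<open>n\<close> occurs; each of them is a relation, so the class does
    not change.\<close>
  let ?d = "action s n - action s' m + (root_part m g + root_part f n + root_part m n)"
  let ?v = "action s g - action s' f + root_part f g"
  have "torus_part (f + m) (g + n) = torus_part f g"
    using m n f g keys by (auto simp: torus_part_linear torus_part_rels)
  moreover have d: "?d \<in> rels"
    using m n f g keys by (intro rels_closed(3,5) action_rels root_part_rels) auto
  moreover note v = bracket_root_part_closed[OF f g, of s s']
  have "lcls (?v + ?d) = lcls ?v"
    using d by (subst lcls_eq_iff[OF order_trans[OF Poly_Mapping.keys_add Un_least[OF v rels_closed(1)[OF d]]] v]) simp
  then have "lcls (action s (g + n) - action s' (f + m) + root_part (f + m) (g + n)) = lcls ?v"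
    by (simp add: action_add root_part_linear algebra_simps)
  ultimately show ?thesis
    by (simp add: bracket_def m n)
qed

section \<open>Bilinearity of the bracket and its prescribed values\<close>

lemma h_space_simps:
  "\<lbrakk>Poly_Mapping.keys f \<subseteq> ext_roots D; Poly_Mapping.keys g \<subseteq> ext_roots D\<rbrakk> \<Longrightarrow>
    (s, lcls f) \<oplus>\<^bsub>h_space \<zeta> D\<^esub> (s', lcls g) = (\<lambda>x. s x + s' x, lcls (f + g))"
  "Poly_Mapping.keys f \<subseteq> ext_roots D \<Longrightarrow>
    c \<odot>\<^bsub>h_space \<zeta> D\<^esub> (s, lcls f) = (\<lambda>x. c * s x, lcls (pscale c f))"
  "\<zero>\<^bsub>h_space \<zeta> D\<^esub> = (\<lambda>_. 0, lcls 0)"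
  by (simp_all add: h_space_def direct_sum_simps lcls_simps)

lemma lcls_in_h_space:
  "(s, lcls f) \<in> carrier (h_space \<zeta> D)"
  if "s \<in> carrier t_space" and "Poly_Mapping.keys f \<subseteq> ext_roots D"
  using that by (auto simp: carrier_h_space carrier_l_space simp del: t_space_simps)

lemma coroot_eq: "coroot \<zeta> D \<alpha> = (\<lambda>x. of_int (lform D \<alpha> x), lcls 0)"
  by (simp add: coroot_def lcls_simps)

lemma X_elem_eq: "X_elem \<zeta> D a = (\<lambda>_. 0, lcls (Poly_Mapping.single a 1))"
  by (simp add: X_elem_def)

lemma coroot_closed: "coroot \<zeta> D \<alpha> \<in> carrier (h_space \<zeta> D)"
  unfolding coroot_eq by (rule lcls_in_h_space) (simp_all add: lform_add_right)

lemma X_elem_closed: "a \<in> ext_roots D \<Longrightarrow> X_elem \<zeta> D a \<in> carrier (h_space \<zeta> D)"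
  unfolding X_elem_eq by (rule lcls_in_h_space) simp_all

lemma bracket_closed:
  assumes "x \<in> carrier (h_space \<zeta> D)" and "y \<in> carrier (h_space \<zeta> D)"
  shows "bracket x y \<in> carrier (h_space \<zeta> D)"
proof -
  obtain s f where x: "x = (s, lcls f)" "s \<in> carrier t_space" "Poly_Mapping.keys f \<subseteq> ext_roots D"
    using assms(1) by (rule h_space_cases)
  obtain s' g where y: "y = (s', lcls g)" "s' \<in> carrier t_space" "Poly_Mapping.keys g \<subseteq> ext_roots D"
    using assms(2) by (rule h_space_cases)
  show ?thesis
    unfolding x(1) y(1) bracket_lcls[OF x(3) y(3)]
    by (rule lcls_in_h_space[OF torus_part_closed bracket_root_part_closed[OF x(3) y(3)]])
qed

lemma bracket_add:
  assumes "x \<in> carrier (h_space \<zeta> D)" and "y \<in> carrier (h_space \<zeta> D)" and "z \<in> carrier (h_space \<zeta> D)"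
  shows "bracket x (y \<oplus>\<^bsub>h_space \<zeta> D\<^esub> z) = bracket x y \<oplus>\<^bsub>h_space \<zeta> D\<^esub> bracket x z"
    and "bracket (y \<oplus>\<^bsub>h_space \<zeta> D\<^esub> z) x = bracket y x \<oplus>\<^bsub>h_space \<zeta> D\<^esub> bracket z x"
proof -
  obtain s f where x: "x = (s, lcls f)" "s \<in> carrier t_space" "Poly_Mapping.keys f \<subseteq> ext_roots D"
    using assms(1) by (rule h_space_cases)
  obtain s' g where y: "y = (s', lcls g)" "s' \<in> carrier t_space" "Poly_Mapping.keys g \<subseteq> ext_roots D"
    using assms(2) by (rule h_space_cases)
  obtain s'' h where z: "z = (s'', lcls h)" "s'' \<in> carrier t_space" "Poly_Mapping.keys h \<subseteq> ext_roots D"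
    using assms(3) by (rule h_space_cases)
  note yz = keys_add_closed[OF y(3) z(3)]
  show "bracket x (y \<oplus>\<^bsub>h_space \<zeta> D\<^esub> z) = bracket x y \<oplus>\<^bsub>h_space \<zeta> D\<^esub> bracket x z"
    unfolding x(1) y(1) z(1) h_space_simps(1)[OF y(3) z(3)] bracket_lcls[OF x(3) y(3)]
      bracket_lcls[OF x(3) z(3)] bracket_lcls[OF x(3) yz]
      h_space_simps(1)[OF bracket_root_part_closed[OF x(3) y(3)] bracket_root_part_closed[OF x(3) z(3)]]
    by (simp add: fun_eq_iff action_add action_add_fun root_part_linear torus_part_linear algebra_simps)
  show "bracket (y \<oplus>\<^bsub>h_space \<zeta> D\<^esub> z) x = bracket y x \<oplus>\<^bsub>h_space \<zeta> D\<^esub> bracket z x"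
    unfolding x(1) y(1) z(1) h_space_simps(1)[OF y(3) z(3)] bracket_lcls[OF y(3) x(3)]
      bracket_lcls[OF z(3) x(3)] bracket_lcls[OF yz x(3)]
      h_space_simps(1)[OF bracket_root_part_closed[OF y(3) x(3)] bracket_root_part_closed[OF z(3) x(3)]]
    by (simp add: fun_eq_iff action_add action_add_fun root_part_linear torus_part_linear algebra_simps)
qed

lemma bracket_smult:
  assumes "x \<in> carrier (h_space \<zeta> D)" and "y \<in> carrier (h_space \<zeta> D)"
  shows "bracket x (c \<odot>\<^bsub>h_space \<zeta> D\<^esub> y) = c \<odot>\<^bsub>h_space \<zeta> D\<^esub> bracket x y"
    and "bracket (c \<odot>\<^bsub>h_space \<zeta> D\<^esub> x) y = c \<odot>\<^bsub>h_space \<zeta> D\<^esub> bracket x y"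
proof -
  obtain s f where x: "x = (s, lcls f)" "s \<in> carrier t_space" "Poly_Mapping.keys f \<subseteq> ext_roots D"
    using assms(1) by (rule h_space_cases)
  obtain s' g where y: "y = (s', lcls g)" "s' \<in> carrier t_space" "Poly_Mapping.keys g \<subseteq> ext_roots D"
    using assms(2) by (rule h_space_cases)
  note rules = bracket_lcls[OF x(3) y(3)] h_space_simps(2)[OF bracket_root_part_closed[OF x(3) y(3)]]
  show "bracket x (c \<odot>\<^bsub>h_space \<zeta> D\<^esub> y) = c \<odot>\<^bsub>h_space \<zeta> D\<^esub> bracket x y"
    unfolding x(1) y(1) rules h_space_simps(2)[OF y(3)] bracket_lcls[OF x(3) keys_pscale_closed[OF y(3)]]
    by (simp add: fun_eq_iff action_pscale action_scale_fun root_part_linear torus_part_linear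
        pscale_add pscale_diff)
  show "bracket (c \<odot>\<^bsub>h_space \<zeta> D\<^esub> x) y = c \<odot>\<^bsub>h_space \<zeta> D\<^esub> bracket x y"
    unfolding x(1) y(1) rules h_space_simps(2)[OF x(3)] bracket_lcls[OF keys_pscale_closed[OF x(3)] y(3)]
    by (simp add: fun_eq_iff action_pscale action_scale_fun root_part_linear torus_part_linear
        pscale_add pscale_diff)
qed

lemma h_bracket_bracket: "h_bracket \<zeta> D bracket"
  unfolding h_bracket_def Let_def
proof (intro conjI ballI)
  fix x assume x: "x \<in> carrier (h_space \<zeta> D)"
  show "bracket x \<in> linear_maps (h_space \<zeta> D) (h_space \<zeta> D)"
    "(\<lambda>y. bracket y x) \<in> linear_maps (h_space \<zeta> D) (h_space \<zeta> D)"
    using x by (simp_all add: linear_maps_def bracket_closed bracket_add bracket_smult)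
next
  fix s s' :: "'l \<Rightarrow> 'k"
  show "bracket (s, \<zero>\<^bsub>l_space \<zeta> D\<^esub>) (s', \<zero>\<^bsub>l_space \<zeta> D\<^esub>) = \<zero>\<^bsub>h_space \<zeta> D\<^esub>"
    by (simp add: lcls_simps bracket_lcls h_space_simps fun_eq_iff torus_part_linear root_part_linear action_zero)
next
  fix \<alpha> b assume b: "b \<in> ext_roots D"
  then have kb: "Poly_Mapping.keys (Poly_Mapping.single b (1::'k)) \<subseteq> ext_roots D"
    by simp
  show "bracket (coroot \<zeta> D \<alpha>) (X_elem \<zeta> D b) = of_int (lform D \<alpha> (fst b)) \<odot>\<^bsub>h_space \<zeta> D\<^esub> X_elem \<zeta> D b"
    using kb by (simp add: coroot_eq X_elem_eq bracket_lcls h_space_simps fun_eq_iff torus_part_linear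
        root_part_linear action_zero action_single)
  \<comment> \<open>\<open>h_bracket\<close> prescribes the negative of this bracket, in the
    additive group of \<open>h_space\<close>. The sign is first computed inside the scalar and then
    moved out as the factor \<open>-1\<close>.\<close>
  have "bracket (X_elem \<zeta> D b) (coroot \<zeta> D \<alpha>)
      = (- of_int (lform D \<alpha> (fst b))) \<odot>\<^bsub>h_space \<zeta> D\<^esub> X_elem \<zeta> D b"
    using kb by (simp add: coroot_eq X_elem_eq bracket_lcls h_space_simps fun_eq_iff torus_part_linear
        root_part_linear action_zero action_single single_uminus)
  then have "(-1) \<odot>\<^bsub>h_space \<zeta> D\<^esub> bracket (X_elem \<zeta> D b) (coroot \<zeta> D \<alpha>)
      = of_int (lform D \<alpha> (fst b)) \<odot>\<^bsub>h_space \<zeta> D\<^esub> X_elem \<zeta> D b"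
    using module.smult_assoc1[OF module_h_space, of "-1" "- of_int (lform D \<alpha> (fst b))" "X_elem \<zeta> D b"]
      X_elem_closed[OF b] by simp
  then show "\<ominus>\<^bsub>h_space \<zeta> D\<^esub> bracket (X_elem \<zeta> D b) (coroot \<zeta> D \<alpha>)
      = of_int (lform D \<alpha> (fst b)) \<odot>\<^bsub>h_space \<zeta> D\<^esub> X_elem \<zeta> D b"
    by (simp add: a_inv_eq_smult[OF module_h_space bracket_closed[OF X_elem_closed[OF b] coroot_closed]])
next
  fix a b assume ab: "a \<in> ext_roots D" "b \<in> ext_roots D"
  then have "bracket (X_elem \<zeta> D a) (X_elem \<zeta> D b) = (\<lambda>x. torus_coeff x a b, lcls (root_coeff a b))"
    by (simp add: X_elem_eq bracket_lcls torus_part_single[abs_def] root_part_single action_zero_fun fun_eq_iff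
        torus_part_single)
  moreover have "a \<otimes>\<^bsub>lat_ext D\<^esub> b \<in> ext_roots D" if "fst a + fst b \<in> roots (lform D)"
    using that ab by (simp add: ext_roots_def)
  ultimately show "bracket (X_elem \<zeta> D a) (X_elem \<zeta> D b) =
      (if fst a + fst b = 0 then
         (eps D (fst a) (fst b) * central_scalar \<zeta> D (a \<otimes>\<^bsub>lat_ext D\<^esub> b)) \<odot>\<^bsub>h_space \<zeta> D\<^esub> coroot \<zeta> D (fst a)
       else if fst a + fst b \<in> roots (lform D) then
         eps D (fst a) (fst b) \<odot>\<^bsub>h_space \<zeta> D\<^esub> X_elem \<zeta> D (a \<otimes>\<^bsub>lat_ext D\<^esub> b)
       else \<zero>\<^bsub>h_space \<zeta> D\<^esub>)"
    by (simp add: torus_coeff_def root_coeff_def coroot_eq X_elem_eq h_space_simps)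
qed

text \<open>The existence of \<open>bracket\<close> opens the \<open>SOME\<close> here. Every later
  statement about the product of \<open>h_lie\<close> rests on \<open>h_bracket\<close>, not on the
  explicit formula.\<close>

lemma h_bracket_h_lie: "h_bracket \<zeta> D (\<lambda>x y. x \<otimes>\<^bsub>h_lie \<zeta> D\<^esub> y)"
  using someI[of "h_bracket \<zeta> D", OF h_bracket_bracket] by (simp add: h_lie_def)

end

section \<open>Spanning sets\<close>

text \<open>Integer multiples in a bare abelian group: depending on the sign of \<open>n\<close>, at
  least one of the two iterates is \<open>0\<close>.\<close>

definition int_mult :: "int \<Rightarrow> 'l::ab_group_add \<Rightarrow> 'l" where
  "int_mult n x = ((+) x ^^ nat n) 0 - ((+) x ^^ nat (- n)) 0"

lemma additive_int_mult:
  fixes g :: "'l::ab_group_add \<Rightarrow> 'r::ring_1"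
  assumes "additive g"
  shows "g (int_mult n x) = of_int n * g x"
proof -
  interpret additive g by fact
  have iter: "g (((+) x ^^ m) 0) = of_nat m * g x" for m
    by (induction m) (simp_all add: zero add algebra_simps)
  show ?thesis
    by (cases "n \<ge> 0") (simp_all add: int_mult_def diff iter zero minus of_nat_nat)
qed

text \<open>Finite generation in the form in which it is applied, as a uniqueness principle. The set
  \<open>F\<close> consists of the images of the standard generators under an isomorphism from the
  free abelian group.\<close>

lemma lattice_finite_generators:
  fixes B :: "'l::ab_group_add \<Rightarrow> 'l \<Rightarrow> int"
  assumes "is_lattice B"
  obtains F :: "'l set" where "finite F"
    and "\<And>g h :: 'l \<Rightarrow> 'r::ring_1. \<lbrakk>additive g; additive h; \<And>x. x \<in> F \<Longrightarrow> g x = h x\<rbrakk> \<Longrightarrow> g = h"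
proof -
  obtain n :: nat where "(add_grp :: 'l monoid) \<cong> free_Abelian_group {..<n}"
    using assms by (auto simp: is_lattice_def)
  then have "free_Abelian_group {..<n} \<cong> (add_grp :: 'l monoid)"
    by (rule group.iso_sym[OF comm_group.axioms(2)[OF comm_group_add_grp]])
  then obtain k where k: "k \<in> iso (free_Abelian_group {..<n}) (add_grp :: 'l monoid)"
    by (auto simp: is_iso_def)
  then have hom: "k \<in> hom (free_Abelian_group {..<n}) add_grp"
    and surj: "k ` carrier (free_Abelian_group {..<n}) = UNIV"
    by (auto simp: iso_def bij_betw_def)
  have khom: "k (a - b) = k a - k b" if "Poly_Mapping.keys a \<subseteq> {..<n}" "Poly_Mapping.keys b \<subseteq> {..<n}" for a b
  proof -
    have "k ((a - b) + b) = k (a - b) + k b"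
      using hom_mult[OF hom, of "a - b" b] that order_trans[OF keys_diff, of a b "{..<n}"] by simp
    then show ?thesis
      by simp
  qed
  show thesis
  proof
    show "finite ((\<lambda>i. k (frag_of i)) ` {..<n})"
      by simp
    fix g h :: "'l \<Rightarrow> 'r"
    assume g: "additive g" and h: "additive h"
      and eq: "\<And>x. x \<in> (\<lambda>i. k (frag_of i)) ` {..<n} \<Longrightarrow> g x = h x"
    \<comment> \<open>\<open>frag_induction\<close> builds elements by differences, which
      \<open>k\<close> is known to respect only on the carrier; therefore the bound on the support
      is part of the induction predicate.\<close>
    have "Poly_Mapping.keys c \<subseteq> {..<n} \<and> g (k c) = h (k c)" if "Poly_Mapping.keys c \<subseteq> {..<n}" for c
      using that
    proof (induction c rule: frag_induction)
      case zero
      have "k 0 = 0"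
        using khom[of 0 0] by simp
      then show ?case
        by (simp add: additive.zero[OF g] additive.zero[OF h])
    next
      case (one x)
      then show ?case
        using eq by simp
    next
      case (diff a b)
      then show ?case
        using order_trans[OF keys_diff, of a b "{..<n}"]
        by (simp add: khom additive.diff[OF g] additive.diff[OF h])
    qed
    then have "g y = h y" if "y \<in> k ` carrier (free_Abelian_group {..<n})" for y
      using that by auto
    then show "g = h"
      unfolding surj by blast
  qed
qed

context lie_datum
begin

text \<open>
  Membership of \<open>x\<close> in the subgroup generated by \<open>F\<close>, up to what additive functions with values in
  the integers and in \<open>'k\<close> can detect.
\<close>

definition detected_by :: "'l set \<Rightarrow> 'l \<Rightarrow> bool" where
  "detected_by F x \<longleftrightarrow>
     (\<forall>g :: 'l \<Rightarrow> int. additive g \<longrightarrow> (\<forall>y\<in>F. g y = 0) \<longrightarrow> g x = 0) \<and>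
     (\<forall>g :: 'l \<Rightarrow> 'k. additive g \<longrightarrow> (\<forall>y\<in>F. g y = 0) \<longrightarrow> g x = 0)"

lemma detected_byD:
  assumes "detected_by F x"
  shows "\<lbrakk>additive (g :: 'l \<Rightarrow> int); \<And>y. y \<in> F \<Longrightarrow> g y = 0\<rbrakk> \<Longrightarrow> g x = 0"
    and "\<lbrakk>additive (h :: 'l \<Rightarrow> 'k); \<And>y. y \<in> F \<Longrightarrow> h y = 0\<rbrakk> \<Longrightarrow> h x = 0"
  using assms unfolding detected_by_def by blast+

lemma lform_int_mult: "lform D (int_mult n x) y = n * lform D x y"
  using additive_int_mult[OF additive_lform(2), of n x y] by simp

text \<open>Projection to the orthogonal complement of \<open>F\<close> with the denominator
  cleared: over the rationals, \<open>u / n\<close> is the component of \<open>v\<close> orthogonal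
  to \<open>F\<close>. The induction is one Gram-Schmidt step, applied to \<open>v\<close> and to
  the new vector \<open>x\<close>.\<close>

lemma orthogonal_projection:
  assumes "finite F"
  shows "\<exists>n>0. \<exists>u. (\<forall>y\<in>F. lform D u y = 0) \<and> detected_by F (int_mult n v - u)"
  using assms
proof (induction F arbitrary: v)
  case empty
  have "detected_by {} (int_mult 1 v - v)"
    by (simp add: detected_by_def additive.diff additive_int_mult)
  then show ?case
    by (intro exI[of _ 1] conjI exI[of _ v]) simp_all
next
  case (insert x F)
  obtain n u where n: "n > 0" and u: "\<And>y. y \<in> F \<Longrightarrow> lform D u y = 0"
    and dv: "detected_by F (int_mult n v - u)"
    using insert.IH[of v] by blast
  obtain m p where m: "m > 0" and p: "\<And>y. y \<in> F \<Longrightarrow> lform D p y = 0"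
    and dx: "detected_by F (int_mult m x - p)"
    using insert.IH[of x] by blast
  \<comment> \<open>The usual correction is \<open>u - (b / a) p\<close>, where \<open>p\<close> is
    the part of \<open>m x\<close> orthogonal to \<open>F\<close>; below it is multiplied by
    \<open>a\<close> to stay in the lattice.\<close>
  define a b where "a = lform D p p" and "b = lform D u p"
  \<comment> \<open>Pairing with \<open>q\<close> is an integer-valued additive function that
    vanishes on \<open>F\<close>, so it does not see \<open>m x - p\<close>.\<close>
  have split_x: "m * lform D q x = lform D q p" if "\<And>y. y \<in> F \<Longrightarrow> lform D q y = 0" for q
  proof -
    have "lform D q (int_mult m x - p) = 0"
      using detected_byD(1)[OF dx additive_lform(1) that] .
    then show ?thesis
      using additive_int_mult[OF additive_lform(1), of q m x] by (simp add: additive.diff[OF additive_lform(1)])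
  qed
  \<comment> \<open>Stated over an arbitrary ring, to serve both clauses of
    \<open>detected_by\<close>. Since \<open>g x = 0\<close>, also \<open>g p = 0\<close>, and what
    remains is \<open>a\<close> times the relation \<open>n v = u\<close> seen by
    \<open>g\<close>.\<close>
  have vanish: "g (int_mult (a * n) v - (int_mult a u - int_mult b p)) = 0"
    if g: "additive g" "\<forall>y\<in>insert x F. g y = 0"
      and dv': "g (int_mult n v - u) = 0" and dx': "g (int_mult m x - p) = 0"
    for g :: "'l \<Rightarrow> 'r::ring_1"
  proof -
    have "g p = 0"
      using dx' g by (simp add: additive.diff additive_int_mult)
    moreover have "of_int n * g v = g u"
      using dv' g by (simp add: additive.diff additive_int_mult)
    ultimately show ?thesis
      using g(1) by (simp add: additive.diff additive_int_mult mult.assoc)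
  qed
  show ?case
  \<comment> \<open>If \<open>p = 0\<close>, a positive multiple of \<open>x\<close> is already
    detected by \<open>F\<close>. There is no pivot, and \<open>u\<close> is orthogonal to
    \<open>x\<close> without correction.\<close>
  proof (cases "p = 0")
    case True
    have "m * lform D u x = 0"
      using split_x[OF u] True by (simp add: additive.zero[OF additive_lform(1)])
    moreover have "detected_by (insert x F) (int_mult n v - u)"
      using dv unfolding detected_by_def by blast
    ultimately show ?thesis
      using n m u by (intro exI[of _ n] conjI exI[of _ u]) auto
  next
    case False
    then have a: "a > 0"
      unfolding a_def by (rule lform_pos)
    define u' where "u' = int_mult a u - int_mult b p"
    have u': "lform D u' y = a * lform D u y - b * lform D p y" for y
      by (simp add: u'_def additive.diff[OF additive_lform(2)] lform_int_mult)
    have "lform D u' y = 0" if "y \<in> F" for y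
      by (simp add: u' u[OF that] p[OF that])
    \<comment> \<open>By the choice of \<open>a\<close> and \<open>b\<close>, the pairing of
      \<open>u'\<close> with \<open>p\<close> is \<open>a b - b a = 0\<close>;
      \<open>split_x\<close> carries this over to \<open>x\<close>, as \<open>m\<close> is
      positive.\<close>
    moreover have "lform D u' x = 0"
      using split_x[of u'] calculation u'[of p] m by (simp add: a_def b_def)
    moreover have "detected_by (insert x F) (int_mult (a * n) v - u')"
      unfolding detected_by_def
    proof (intro conjI allI impI)
      fix g :: "'l \<Rightarrow> int" assume g: "additive g" "\<forall>y\<in>insert x F. g y = 0"
      then have "g (int_mult n v - u) = 0" "g (int_mult m x - p) = 0"
        using detected_byD(1)[OF dv g(1)] detected_byD(1)[OF dx g(1)] by auto
      then show "g (int_mult (a * n) v - u') = 0"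
        using vanish[OF g] unfolding u'_def by blast
    next
      fix g :: "'l \<Rightarrow> 'k" assume g: "additive g" "\<forall>y\<in>insert x F. g y = 0"
      then have "g (int_mult n v - u) = 0" "g (int_mult m x - p) = 0"
        using detected_byD(2)[OF dv g(1)] detected_byD(2)[OF dx g(1)] by auto
      then show "g (int_mult (a * n) v - u') = 0"
        using vanish[OF g] unfolding u'_def by blast
    qed
    ultimately show ?thesis
      using a n by (intro exI[of _ "a * n"] conjI exI[of _ u']) auto
  qed
qed

text \<open>A value is corrected at one point at a time: a multiple of the pairing with a vector
  \<open>u\<close> orthogonal to \<open>F\<close> leaves the values on \<open>F\<close> alone.
  \<open>K\<close> is kept abstract so that an induction predicate can be put in its place.\<close>

lemma interpolation:
  fixes s :: "'l \<Rightarrow> 'k"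
  assumes "finite F" and s: "additive s"
    and K: "(\<lambda>_. 0) \<in> K" "\<And>t c u. t \<in> K \<Longrightarrow> (\<lambda>x. t x + c * of_int (lform D u x)) \<in> K"
      "\<And>t. t \<in> K \<Longrightarrow> additive t"
  shows "\<exists>t\<in>K. \<forall>y\<in>F. t y = s y"
  using assms(1)
proof induction
  case empty
  then show ?case
    using K(1) by blast
next
  case (insert x F)
  then obtain t where t: "t \<in> K" "\<And>y. y \<in> F \<Longrightarrow> t y = s y"
    by blast
  obtain n u where n: "n > 0" and u: "\<And>y. y \<in> F \<Longrightarrow> lform D u y = 0"
    and d: "detected_by F (int_mult n x - u)"
    using orthogonal_projection[OF insert.hyps(1), of x] by blast
  show ?case
  proof (cases "u = 0")
    case True
    \<comment> \<open>With \<open>u = 0\<close> the multiple \<open>n x\<close> itself is detected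
      by \<open>F\<close>. The difference \<open>s - t\<close> vanishes on \<open>F\<close>, hence
      at \<open>n x\<close>, and characteristic zero allows division by \<open>n\<close>.\<close>
    have add: "additive (\<lambda>y. s y - t y)"
      using s K(3)[OF t(1)] by (simp add: additive_def)
    have "s (int_mult n x - u) - t (int_mult n x - u) = 0"
      by (rule detected_byD(2)[OF d add]) (simp add: t(2))
    then have "of_int n * (s x - t x) = 0"
      using additive_int_mult[OF add, of n x] True by simp
    then show ?thesis
      using n t by (intro bexI[of _ t]) auto
  next
    case False
    \<comment> \<open>Testing with the pairing against \<open>u\<close> gives
      \<open>n (u, x) = (u, u) > 0\<close>, so \<open>(u, x)\<close> is nonzero and is invertible in
      \<open>'k\<close>, which the coefficient \<open>c\<close> requires.\<close>
    have "lform D u (int_mult n x - u) = 0"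
      using detected_byD(1)[OF d additive_lform(1) u] .
    then have "n * lform D u x = lform D u u"
      using additive_int_mult[OF additive_lform(1), of u n x] by (simp add: additive.diff[OF additive_lform(1)])
    then have nz: "lform D u x \<noteq> 0"
      using lform_pos[OF False] by auto
    define c where "c = (s x - t x) / of_int (lform D u x)"
    have "(\<lambda>y. t y + c * of_int (lform D u y)) \<in> K"
      by (rule K(2)[OF t(1)])
    moreover have "\<forall>y\<in>insert x F. t y + c * of_int (lform D u y) = s y"
      using nz t(2) u by (simp add: c_def)
    ultimately show ?thesis
      by (intro bexI[of _ "\<lambda>y. t y + c * of_int (lform D u y)"])
  qed
qed

text \<open>That the coroots span is expressed as an induction rule: interpolation on a finite
  generating set of the lattice yields a functional with property \<open>P\<close> that coincides
  with \<open>s\<close>.\<close>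

lemma t_space_induct [consumes 1, case_names zero add]:
  assumes s: "s \<in> carrier t_space" and "P (\<lambda>_. 0)"
    and step: "\<And>t c \<alpha>. \<lbrakk>t \<in> carrier t_space; P t; \<alpha> \<in> roots (lform D)\<rbrakk> \<Longrightarrow> P (\<lambda>x. t x + c * of_int (lform D \<alpha> x))"
  shows "P (s :: 'l \<Rightarrow> 'k)"
proof -
  define K where "K = {t \<in> carrier t_space. P t}"
  have closed: "(\<lambda>x. t x + c * of_int (lform D u x)) \<in> carrier t_space" if "t \<in> carrier t_space" for t :: "'l \<Rightarrow> 'k" and c u
    using that by (simp add: lform_add_right algebra_simps)
  \<comment> \<open>Interpolation needs pairings with arbitrary lattice vectors, while
    \<open>P\<close> is preserved for roots only. The quantifier over \<open>t\<close> lets a sum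
    \<open>u + v\<close> be added in two successive steps; an inverse is handled by
    \<open>- c\<close>.\<close>
  have "\<forall>t\<in>K. \<forall>c. (\<lambda>x. t x + c * of_int (lform D u x)) \<in> K" if "u \<in> generate add_grp (roots (lform D))" for u
    using that
  proof induction
    case one
    then show ?case
      by (simp add: additive.zero[OF additive_lform(2)])
  next
    case (incl \<alpha>)
    then show ?case
      using step closed unfolding K_def by blast
  next
    case (inv \<alpha>)
    show ?case
    proof (intro ballI allI)
      fix t c assume "t \<in> K"
      then have "(\<lambda>x. t x + (- c) * of_int (lform D \<alpha> x)) \<in> K"
        using step closed inv unfolding K_def by blast
      then show "(\<lambda>x. t x + c * of_int (lform D (inv\<^bsub>add_grp\<^esub> \<alpha>) x)) \<in> K"
        by (simp add: additive.minus[OF additive_lform(2)])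
    qed
  next
    case (eng u v)
    show ?case
    proof (intro ballI allI)
      fix t c assume "t \<in> K"
      then have "(\<lambda>x. t x + c * of_int (lform D u x)) \<in> K"
        using eng.IH(1) by blast
      from bspec[OF eng.IH(2) this] have "(\<lambda>x. (t x + c * of_int (lform D u x)) + c * of_int (lform D v x)) \<in> K"
        by (rule spec)
      then show "(\<lambda>x. t x + c * of_int (lform D (u \<otimes>\<^bsub>add_grp\<^esub> v) x)) \<in> K"
        by (simp add: lform_add_left algebra_simps)
    qed
  qed
  then have K2: "(\<lambda>x. t x + c * of_int (lform D u x)) \<in> K" if "t \<in> K" for t c u
    using that generate_roots by blast
  obtain F :: "'l set" where F: "finite F"
    "\<And>g h :: 'l \<Rightarrow> 'k. \<lbrakk>additive g; additive h; \<And>x. x \<in> F \<Longrightarrow> g x = h x\<rbrakk> \<Longrightarrow> g = h"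
    using lattice_finite_generators[OF lattice] by metis
  have add: "additive t" if "t \<in> carrier t_space" for t :: "'l \<Rightarrow> 'k"
    using that by (simp add: additive_def)
  have "\<exists>t\<in>K. \<forall>y\<in>F. t y = s y"
  proof (rule interpolation[OF F(1) add[OF s]])
    show "(\<lambda>_. 0) \<in> K"
      using assms(2) by (simp add: K_def)
  qed (use K2 add in \<open>auto simp: K_def simp del: t_space_simps\<close>)
  then obtain t where "t \<in> K" "\<And>y. y \<in> F \<Longrightarrow> t y = s y"
    by blast
  then have "P t" and "t = s"
    using F(2)[OF add add] s unfolding K_def by auto
  then show ?thesis
    by simp
qed

lemma h_space_induct [consumes 1, case_names coroot X zero add smult]:
  assumes x: "x \<in> carrier (h_space \<zeta> D)"
    and coroot: "\<And>\<alpha>. \<alpha> \<in> roots (lform D) \<Longrightarrow> P (coroot \<zeta> D \<alpha>)"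
    and X: "\<And>a. a \<in> ext_roots D \<Longrightarrow> P (X_elem \<zeta> D a)"
    and zero: "P \<zero>\<^bsub>h_space \<zeta> D\<^esub>"
    and add: "\<And>y z. \<lbrakk>y \<in> carrier (h_space \<zeta> D); z \<in> carrier (h_space \<zeta> D); P y; P z\<rbrakk> \<Longrightarrow> P (y \<oplus>\<^bsub>h_space \<zeta> D\<^esub> z)"
    and smult: "\<And>c y. \<lbrakk>y \<in> carrier (h_space \<zeta> D); P y\<rbrakk> \<Longrightarrow> P (c \<odot>\<^bsub>h_space \<zeta> D\<^esub> y)"
  shows "P x"
proof -
  obtain s f where sf: "x = (s, lcls f)" "s \<in> carrier t_space" "Poly_Mapping.keys f \<subseteq> ext_roots D"
    using x by (rule h_space_cases)
  from sf(2) have "P (s, lcls 0)"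
  proof (induction rule: t_space_induct)
    case zero
    then show ?case
      using assms(4) by (simp add: h_space_simps)
  next
    case (add t c \<alpha>)
    have "P ((t, lcls 0) \<oplus>\<^bsub>h_space \<zeta> D\<^esub> c \<odot>\<^bsub>h_space \<zeta> D\<^esub> coroot \<zeta> D \<alpha>)"
    proof (rule assms(5))
      show "(t, lcls 0) \<in> carrier (h_space \<zeta> D)"
        using add by (intro lcls_in_h_space) auto
      show "c \<odot>\<^bsub>h_space \<zeta> D\<^esub> coroot \<zeta> D \<alpha> \<in> carrier (h_space \<zeta> D)"
        using module.smult_closed[OF module_h_space, of c] coroot_closed by simp
    qed (use add coroot smult coroot_closed in auto)
    then show ?case
      by (simp add: coroot_eq h_space_simps)
  qed
  \<comment> \<open>The support is carried along because classes can be added by representatives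
    only when these lie in the free space over \<open>ext_roots D\<close>.\<close>
  moreover have "P (\<lambda>_. 0, lcls (\<Sum>a\<in>A. Poly_Mapping.single a (Poly_Mapping.lookup f a)))
      \<and> Poly_Mapping.keys (\<Sum>a\<in>A. Poly_Mapping.single a (Poly_Mapping.lookup f a)) \<subseteq> ext_roots D"
    if "finite A" "A \<subseteq> Poly_Mapping.keys f" for A
    using that
  proof induction
    case empty
    then show ?case
      using zero by (simp add: h_space_simps)
  next
    case (insert a A)
    let ?c = "Poly_Mapping.lookup f a"
    let ?S = "\<Sum>a\<in>A. Poly_Mapping.single a (Poly_Mapping.lookup f a)"
    from insert have a: "a \<in> ext_roots D" and S: "P (\<lambda>_. 0, lcls ?S)" "Poly_Mapping.keys ?S \<subseteq> ext_roots D"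
      using sf(3) by auto
    have k: "Poly_Mapping.keys (Poly_Mapping.single a ?c) \<subseteq> ext_roots D"
      using a by simp
    have "P (?c \<odot>\<^bsub>h_space \<zeta> D\<^esub> X_elem \<zeta> D a)"
      using a X smult X_elem_closed by simp
    then have "P (\<lambda>_. 0, lcls (Poly_Mapping.single a ?c))"
      using a by (simp add: X_elem_eq h_space_simps)
    then have "P ((\<lambda>_. 0, lcls (Poly_Mapping.single a ?c)) \<oplus>\<^bsub>h_space \<zeta> D\<^esub> (\<lambda>_. 0, lcls ?S))"
      using S k by (intro add lcls_in_h_space) auto
    then show ?case
      using insert(1,2) S(2) k keys_add_closed[OF k S(2)] by (simp add: h_space_simps)
  qed
  from this[OF finite_keys order_refl] have "P (\<lambda>_. 0, lcls f)"
    by (simp flip: sum_single_lookup)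
  ultimately have "P ((s, lcls 0) \<oplus>\<^bsub>h_space \<zeta> D\<^esub> (\<lambda>_. 0, lcls f))"
    using sf by (intro add lcls_in_h_space) auto
  then show ?thesis
    using sf by (simp add: h_space_simps)
qed

end

section \<open>The induced map\<close>

context lie_datum
begin

lemma linear_maps_eq:
  fixes W :: "('k, 'u) module"
  assumes W: "module scalars W"
    and f: "f \<in> linear_maps (h_space \<zeta> D) W" and g: "g \<in> linear_maps (h_space \<zeta> D) W"
    and coroot: "\<And>\<alpha>. \<alpha> \<in> roots (lform D) \<Longrightarrow> f (coroot \<zeta> D \<alpha>) = g (coroot \<zeta> D \<alpha>)"
    and X_elem: "\<And>a. a \<in> ext_roots D \<Longrightarrow> f (X_elem \<zeta> D a) = g (X_elem \<zeta> D a)"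
    and x: "x \<in> carrier (h_space \<zeta> D)"
  shows "f x = g x"
  using x
proof (induction rule: h_space_induct)
  case zero
  show ?case
    by (simp add: linear_maps_zero[OF module_h_space W f] linear_maps_zero[OF module_h_space W g])
qed (simp_all add: coroot X_elem linear_mapsD[OF f] linear_mapsD[OF g])

lemma h_lie_mult_linear:
  assumes "x \<in> carrier (h_space \<zeta> D)"
  shows "(\<lambda>y. x \<otimes>\<^bsub>h_lie \<zeta> D\<^esub> y) \<in> linear_maps (h_space \<zeta> D) (h_space \<zeta> D)"
    and "(\<lambda>y. y \<otimes>\<^bsub>h_lie \<zeta> D\<^esub> x) \<in> linear_maps (h_space \<zeta> D) (h_space \<zeta> D)"
  using h_bracket_h_lie assms unfolding h_bracket_def Let_def by auto

lemma h_lie_mult_coroot_coroot: "coroot \<zeta> D \<alpha> \<otimes>\<^bsub>h_lie \<zeta> D\<^esub> coroot \<zeta> D \<beta> = \<zero>\<^bsub>h_space \<zeta> D\<^esub>"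
  using h_bracket_h_lie unfolding h_bracket_def Let_def coroot_def
  by (simp add: lform_add_right)

lemma h_lie_mult_coroot_X:
  assumes "\<alpha> \<in> roots (lform D)" and "b \<in> ext_roots D"
  shows "coroot \<zeta> D \<alpha> \<otimes>\<^bsub>h_lie \<zeta> D\<^esub> X_elem \<zeta> D b
    = of_int (lform D \<alpha> (fst b)) \<odot>\<^bsub>h_space \<zeta> D\<^esub> X_elem \<zeta> D b"
  using h_bracket_h_lie assms unfolding h_bracket_def Let_def by blast

lemma h_lie_mult_X_coroot:
  assumes "\<alpha> \<in> roots (lform D)" and "b \<in> ext_roots D"
  shows "X_elem \<zeta> D b \<otimes>\<^bsub>h_lie \<zeta> D\<^esub> coroot \<zeta> D \<alpha>
    = (- of_int (lform D \<alpha> (fst b))) \<odot>\<^bsub>h_space \<zeta> D\<^esub> X_elem \<zeta> D b" (is "?z = _")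
proof -
  have z: "?z \<in> carrier (h_space \<zeta> D)"
    using linear_mapsD(1)[OF h_lie_mult_linear(1)[OF X_elem_closed[OF assms(2)]] coroot_closed] .
  have "\<ominus>\<^bsub>h_space \<zeta> D\<^esub> ?z = of_int (lform D \<alpha> (fst b)) \<odot>\<^bsub>h_space \<zeta> D\<^esub> X_elem \<zeta> D b"
    using h_bracket_h_lie assms unfolding h_bracket_def Let_def by blast
  then have "(-1) \<odot>\<^bsub>h_space \<zeta> D\<^esub> ((-1) \<odot>\<^bsub>h_space \<zeta> D\<^esub> ?z)
      = (-1) \<odot>\<^bsub>h_space \<zeta> D\<^esub> (of_int (lform D \<alpha> (fst b)) \<odot>\<^bsub>h_space \<zeta> D\<^esub> X_elem \<zeta> D b)"
    using a_inv_eq_smult[OF module_h_space z] by simp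
  then show ?thesis
    using module.smult_assoc1[OF module_h_space, of "-1" "-1" ?z]
      module.smult_assoc1[OF module_h_space, of "-1" "of_int (lform D \<alpha> (fst b))" "X_elem \<zeta> D b"]
      module.smult_one[OF module_h_space z] z X_elem_closed[OF assms(2)]
    by simp
qed

lemma h_lie_mult_X_X:
  assumes "a \<in> ext_roots D" and "b \<in> ext_roots D"
  shows "X_elem \<zeta> D a \<otimes>\<^bsub>h_lie \<zeta> D\<^esub> X_elem \<zeta> D b =
    (if fst a + fst b = 0 then
       (eps D (fst a) (fst b) * central_scalar \<zeta> D (a \<otimes>\<^bsub>lat_ext D\<^esub> b)) \<odot>\<^bsub>h_space \<zeta> D\<^esub> coroot \<zeta> D (fst a)
     else if fst a + fst b \<in> roots (lform D) then
       eps D (fst a) (fst b) \<odot>\<^bsub>h_space \<zeta> D\<^esub> X_elem \<zeta> D (a \<otimes>\<^bsub>lat_ext D\<^esub> b)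
     else \<zero>\<^bsub>h_space \<zeta> D\<^esub>)"
  using h_bracket_h_lie assms unfolding h_bracket_def Let_def by blast

end

locale lie_datum_iso = dom: lie_datum \<zeta> D + cod: lie_datum \<zeta> D'
  for \<zeta> :: "'k::field_char_0"
    and D :: "('l::ab_group_add, 'h, 'k) datum"
    and D' :: "('m::ab_group_add, 'g, 'k) datum" +
  fixes \<psi> :: "'l \<Rightarrow> 'm" and \<phi> :: "'h \<Rightarrow> 'g"
  assumes iso: "datum_iso \<zeta> D D' \<psi> \<phi>"
begin

section \<open>Transport of the extension and of the roots\<close>

lemma additive_psi: "additive \<psi>"
  and bij_psi: "bij \<psi>"
  and lform_psi: "lform D' (\<psi> x) (\<psi> y) = lform D x y"
  using iso by (auto simp: datum_iso_def lattice_iso_def iso_def hom_def intro: additive.intro)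

lemma psi_laut: "\<psi> (laut D x) = laut D' (\<psi> x)"
  using iso by (auto simp: datum_iso_def dest: fun_cong)

lemma eps_psi: "eps D' (\<psi> \<alpha>) (\<psi> \<beta>) = eps D \<alpha> \<beta>"
  and iso_phi: "\<phi> \<in> iso (ext D) (ext D')"
  and phi_emb: "c \<in> carrier (mu \<zeta>) \<Longrightarrow> \<phi> (emb D c) = emb D' c"
  and proj_phi: "\<lbrakk>h \<in> carrier (ext D); proj D h = coinv_class (laut D) x\<rbrakk> \<Longrightarrow>
    proj D' (\<phi> h) = coinv_class (laut D') (\<psi> x)"
  using iso unfolding datum_iso_def by blast+

lemma phi_closed: "h \<in> carrier (ext D) \<Longrightarrow> \<phi> h \<in> carrier (ext D')"
  and phi_mult: "\<lbrakk>g \<in> carrier (ext D); h \<in> carrier (ext D)\<rbrakk> \<Longrightarrow>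
    \<phi> (g \<otimes>\<^bsub>ext D\<^esub> h) = \<phi> g \<otimes>\<^bsub>ext D'\<^esub> \<phi> h"
  and bij_phi: "bij_betw \<phi> (carrier (ext D)) (carrier (ext D'))"
  using iso_phi by (auto simp: Group.iso_def hom_def)

text \<open>As \<open>\<psi>\<close> is bijective and intertwines the two automorphisms, it carries
  the image of \<open>1 - w\<close> exactly onto the image of \<open>1 - w'\<close>; so the map on
  coinvariants is injective.\<close>

lemma coinv_class_psi_eq_iff:
  "coinv_class (laut D') (\<psi> x) = coinv_class (laut D') (\<psi> y)
    \<longleftrightarrow> coinv_class (laut D) x = coinv_class (laut D) y"
proof -
  have "\<psi> x - \<psi> y \<in> coinv_ker (laut D') \<longleftrightarrow> (\<exists>z. \<psi> (x - y) = \<psi> z - laut D' (\<psi> z))"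
    using bij_psi by (auto simp: coinv_ker_def additive.diff[OF additive_psi] bij_def) (metis surjD)
  also have "\<dots> \<longleftrightarrow> x - y \<in> coinv_ker (laut D)"
    using bij_psi
    by (auto simp: coinv_ker_def bij_def inj_eq simp flip: psi_laut additive.diff[OF additive_psi])
  finally show ?thesis
    by (simp add: coinv_class_eq_iff dom.additive_laut cod.additive_laut)
qed

text \<open>\<open>datum_iso\<close> supplies one direction. The converse compares \<open>x\<close>
  with a lattice point that represents \<open>proj D h\<close>; it is needed for the surjectivity of
  \<open>map_prod \<psi> \<phi>\<close> and for the inverse pair.\<close>

lemma proj_phi_iff:
  assumes h: "h \<in> carrier (ext D)"
  shows "proj D' (\<phi> h) = coinv_class (laut D') (\<psi> x) \<longleftrightarrow> proj D h = coinv_class (laut D) x"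
proof -
  obtain y where y: "proj D h = coinv_class (laut D) y"
    using dom.proj_is_class[OF h] .
  then show ?thesis
    using proj_phi[OF h y] coinv_class_psi_eq_iff by auto
qed

lemma map_prod_iso: "map_prod \<psi> \<phi> \<in> Group.iso (lat_ext D) (lat_ext D')"
proof -
  have closed: "map_prod \<psi> \<phi> a \<in> carrier (lat_ext D') \<longleftrightarrow> a \<in> carrier (lat_ext D)"
    if "snd a \<in> carrier (ext D)" for a
    using that proj_phi_iff[of "snd a" "fst a"] phi_closed by (auto simp: carrier_lat_ext_iff)
  have "inj_on (map_prod \<psi> \<phi>) (carrier (lat_ext D))"
  proof (rule inj_onI)
    fix a b assume "a \<in> carrier (lat_ext D)" "b \<in> carrier (lat_ext D)" "map_prod \<psi> \<phi> a = map_prod \<psi> \<phi> b"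
    then show "a = b"
      using inj_onD[OF bij_betw_imp_inj_on[OF bij_phi], of "snd a" "snd b"] bij_psi
      by (cases a; cases b) (simp add: carrier_lat_ext_iff bij_def inj_eq)
  qed
  moreover have "carrier (lat_ext D') \<subseteq> map_prod \<psi> \<phi> ` carrier (lat_ext D)"
  proof
    fix a assume a: "a \<in> carrier (lat_ext D')"
    obtain x where x: "fst a = \<psi> x"
      using bij_psi by (metis bij_pointE)
    obtain h where h: "snd a = \<phi> h" "h \<in> carrier (ext D)"
      using a bij_betw_imp_surj_on[OF bij_phi] by (auto simp: carrier_lat_ext_iff)
    have "a = map_prod \<psi> \<phi> (x, h)"
      using x h by (simp add: prod_eq_iff)
    then show "a \<in> map_prod \<psi> \<phi> ` carrier (lat_ext D)"
      using a h closed[of "(x, h)"] by (metis image_eqI snd_conv)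
  qed
  ultimately show ?thesis
    using closed phi_mult
    by (auto simp: Group.iso_def hom_def bij_betw_def lat_ext_mult additive.add[OF additive_psi] carrier_lat_ext_iff)
qed

lemma map_prod_closed: "a \<in> carrier (lat_ext D) \<Longrightarrow> map_prod \<psi> \<phi> a \<in> carrier (lat_ext D')"
  and map_prod_mult: "\<lbrakk>a \<in> carrier (lat_ext D); b \<in> carrier (lat_ext D)\<rbrakk> \<Longrightarrow>
    map_prod \<psi> \<phi> (a \<otimes>\<^bsub>lat_ext D\<^esub> b) = map_prod \<psi> \<phi> a \<otimes>\<^bsub>lat_ext D'\<^esub> map_prod \<psi> \<phi> b"
  using map_prod_iso unfolding Group.iso_def hom_def by blast+

lemma map_prod_lat_emb: "c \<in> carrier (mu \<zeta>) \<Longrightarrow> map_prod \<psi> \<phi> (lat_emb D c) = lat_emb D' c"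
  by (simp add: lat_emb_def phi_emb additive.zero[OF additive_psi])

lemma psi_roots: "\<psi> \<alpha> \<in> roots (lform D') \<longleftrightarrow> \<alpha> \<in> roots (lform D)"
  by (simp add: roots_def lform_psi)

lemma map_prod_ext_roots: "a \<in> ext_roots D \<Longrightarrow> map_prod \<psi> \<phi> a \<in> ext_roots D'"
  using map_prod_closed by (simp add: ext_roots_def psi_roots)

lemma map_prod_zmult:
  "a \<in> ext_roots D \<Longrightarrow> map_prod \<psi> \<phi> (dom.zmult a) = cod.zmult (map_prod \<psi> \<phi> a)"
  by (simp add: map_prod_mult map_prod_lat_emb dom.ext_roots_carrier zeta_in_mu)

lemma central_scalar_map_prod:
  assumes "a \<in> carrier (lat_ext D)" and "fst a = 0"
  shows "central_scalar \<zeta> D' (map_prod \<psi> \<phi> a) = central_scalar \<zeta> D a"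
proof -
  obtain c where c: "c \<in> carrier (mu \<zeta>)" "a = lat_emb D c"
    using dom.obtain_central_scalar[OF assms] .
  then show ?thesis
    by (simp add: map_prod_lat_emb dom.central_scalar_lat_emb cod.central_scalar_lat_emb)
qed

text \<open>Makes everything proved for the pair available for its inverse, whose induced map will
  be the inverse map.\<close>

lemma datum_iso_sym: "datum_iso \<zeta> D' D (inv_into UNIV \<psi>) (inv_into (carrier (ext D)) \<phi>)"
proof -
  let ?\<psi> = "inv_into UNIV \<psi>" and ?\<phi> = "inv_into (carrier (ext D)) \<phi>"
  have inv1: "\<psi> (?\<psi> y) = y" "?\<psi> (\<psi> x) = x" for x y
    using bij_psi by (simp_all add: bij_def surj_f_inv_f)
  have eqI: "x = y" if "\<psi> x = \<psi> y" for x y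
    using that inv1 by metis
  have inv2: "\<phi> (?\<phi> g) = g" "?\<phi> g \<in> carrier (ext D)" if "g \<in> carrier (ext D')" for g
    using that bij_betw_imp_surj_on[OF bij_phi] by (auto intro: f_inv_into_f inv_into_into)
  have inv3: "?\<phi> (\<phi> h) = h" if "h \<in> carrier (ext D)" for h
    using that bij_betw_imp_inj_on[OF bij_phi] by (rule inv_into_f_f[rotated])
  have "?\<psi> (x + y) = ?\<psi> x + ?\<psi> y" for x y
    by (rule eqI) (simp add: inv1 additive.add[OF additive_psi])
  then have "?\<psi> \<in> lattice_iso (lform D') (lform D)"
    using bij_imp_bij_inv[OF bij_psi] lform_psi[of "?\<psi> _" "?\<psi> _"]
    by (simp add: lattice_iso_def Group.iso_def hom_def inv1)
  moreover have "?\<psi> (laut D' y) = laut D (?\<psi> y)" for y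
    by (rule eqI) (simp add: inv1 psi_laut)
  then have "?\<psi> \<circ> laut D' = laut D \<circ> ?\<psi>"
    by (simp add: fun_eq_iff)
  moreover have "eps D (?\<psi> \<alpha>) (?\<psi> \<beta>) = eps D' \<alpha> \<beta>" for \<alpha> \<beta>
    using eps_psi[of "?\<psi> \<alpha>" "?\<psi> \<beta>"] by (simp add: inv1)
  moreover have "?\<phi> \<in> Group.iso (ext D') (ext D)"
    by (rule dom.ext.iso_set_sym[OF iso_phi])
  moreover have "?\<phi> (emb D' c) = emb D c" if "c \<in> carrier (mu \<zeta>)" for c
    using inv3[of "emb D c"] that by (simp add: phi_emb)
  moreover have "proj D (?\<phi> h) = coinv_class (laut D) (?\<psi> x)"
    if "h \<in> carrier (ext D')" "proj D' h = coinv_class (laut D') x" for h x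
    using that proj_phi_iff[of "?\<phi> h" "?\<psi> x"] inv2[of h] by (simp add: inv1)
  ultimately show ?thesis
    unfolding datum_iso_def by blast
qed

definition push :: "('l \<times> 'h \<Rightarrow>\<^sub>0 'k) \<Rightarrow> ('m \<times> 'g \<Rightarrow>\<^sub>0 'k)" where
  "push = lin_ext pscale (\<lambda>a. Poly_Mapping.single (map_prod \<psi> \<phi> a) 1)"

lemma push_simps:
  "push (f + g) = push f + push g"
  "push (f - g) = push f - push g"
  "push (pscale c f) = pscale c (push f)"
  "push 0 = 0"
  "push (Poly_Mapping.single a c) = Poly_Mapping.single (map_prod \<psi> \<phi> a) c"
  by (simp_all add: push_def vector_space.lin_ext_add[OF vector_space_pscale]
      vector_space.lin_ext_diff[OF vector_space_pscale] vector_space.lin_ext_pscale[OF vector_space_pscale]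
      vector_space.lin_ext_zero[OF vector_space_pscale] vector_space.lin_ext_single[OF vector_space_pscale])

lemma push_closed:
  "Poly_Mapping.keys f \<subseteq> ext_roots D \<Longrightarrow> Poly_Mapping.keys (push f) \<subseteq> ext_roots D'"
  unfolding push_def by (rule lin_ext_in_free_space) (use map_prod_ext_roots in auto)

text \<open>Since \<open>\<phi>\<close> is the identity on the powers of \<open>\<zeta>\<close>, the
  generator at \<open>a\<close> goes to the generator at the image of \<open>a\<close>.\<close>

lemma push_rels: "f \<in> dom.rels \<Longrightarrow> push f \<in> cod.rels"
proof (induction rule: dom.rels_induct)
  case (base a)
  then show ?case
    using cod.rels_generator[OF map_prod_ext_roots[OF base], of 1] by (simp only: push_simps map_prod_zmult mult_1_right)
qed (simp_all add: push_simps cod.rels_closed)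

text \<open>Precomposition with the inverse of \<open>\<psi>\<close> is defined on every functional
  at once. Invariance of the form, \<open>(\<alpha>, inv \<psi> y) = (\<psi> \<alpha>, y)\<close>,
  shows that it sends the coroot of \<open>\<alpha>\<close> to the coroot of
  \<open>\<psi> \<alpha>\<close>.\<close>

definition induced :: "('l, 'h, 'k) h_elem \<Rightarrow> ('m, 'g, 'k) h_elem" where
  "induced x = (\<lambda>y. fst x (inv_into UNIV \<psi> y), cod.lcls (push (dom.lrep (snd x))))"

lemma induced_lcls:
  assumes f: "Poly_Mapping.keys f \<subseteq> ext_roots D"
  shows "induced (s, dom.lcls f) = (\<lambda>y. s (inv_into UNIV \<psi> y), cod.lcls (push f))"
proof -
  obtain n where n: "n \<in> dom.rels" "dom.lrep (dom.lcls f) = f + n"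
    using dom.lrep_lcls[OF f] .
  have "cod.lcls (push f + push n) = cod.lcls (push f)"
    using push_rels[OF n(1)]
    by (subst cod.lcls_eq_iff[OF keys_add_closed[OF push_closed[OF f]] push_closed[OF f]])
      (simp_all add: cod.rels_closed(1))
  then show ?thesis
    by (simp add: induced_def n push_simps)
qed

lemma induced_linear: "induced \<in> linear_maps (h_space \<zeta> D) (h_space \<zeta> D')"
proof -
  have inv_add: "inv_into UNIV \<psi> (x + y) = inv_into UNIV \<psi> x + inv_into UNIV \<psi> y" for x y
    using datum_iso_sym by (simp add: datum_iso_def lattice_iso_def Group.iso_def hom_def)
  have "induced x \<in> carrier (h_space \<zeta> D')" if hx: "x \<in> carrier (h_space \<zeta> D)" for x
  proof -
    obtain s f where x: "x = (s, dom.lcls f)" "s \<in> carrier t_space" "Poly_Mapping.keys f \<subseteq> ext_roots D"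
      using hx by (rule dom.h_space_cases)
    show ?thesis
      unfolding x(1) induced_lcls[OF x(3)]
      by (rule cod.lcls_in_h_space[OF _ push_closed[OF x(3)]]) (use x(2) in \<open>simp add: inv_add\<close>)
  qed
  moreover have "induced (x \<oplus>\<^bsub>h_space \<zeta> D\<^esub> y) = induced x \<oplus>\<^bsub>h_space \<zeta> D'\<^esub> induced y"
    if hx: "x \<in> carrier (h_space \<zeta> D)" and hy: "y \<in> carrier (h_space \<zeta> D)" for x y
  proof -
    obtain s f where x: "x = (s, dom.lcls f)" "s \<in> carrier t_space" "Poly_Mapping.keys f \<subseteq> ext_roots D"
      using hx by (rule dom.h_space_cases)
    obtain s' g where y: "y = (s', dom.lcls g)" "s' \<in> carrier t_space" "Poly_Mapping.keys g \<subseteq> ext_roots D"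
      using hy by (rule dom.h_space_cases)
    show ?thesis
      unfolding x(1) y(1) induced_lcls[OF x(3)] induced_lcls[OF y(3)] dom.h_space_simps(1)[OF x(3) y(3)]
        induced_lcls[OF keys_add_closed[OF x(3) y(3)]] cod.h_space_simps(1)[OF push_closed[OF x(3)] push_closed[OF y(3)]]
      by (simp add: push_simps)
  qed
  moreover have "induced (c \<odot>\<^bsub>h_space \<zeta> D\<^esub> x) = c \<odot>\<^bsub>h_space \<zeta> D'\<^esub> induced x"
    if hx: "x \<in> carrier (h_space \<zeta> D)" for c x
  proof -
    obtain s f where x: "x = (s, dom.lcls f)" "s \<in> carrier t_space" "Poly_Mapping.keys f \<subseteq> ext_roots D"
      using hx by (rule dom.h_space_cases)
    show ?thesis
      unfolding x(1) induced_lcls[OF x(3)] dom.h_space_simps(2)[OF x(3)]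
        induced_lcls[OF keys_pscale_closed[OF x(3)]] cod.h_space_simps(2)[OF push_closed[OF x(3)]]
      by (simp add: push_simps)
  qed
  ultimately show ?thesis
    by (simp add: linear_maps_def)
qed

lemma induced_map_induced: "induced_map \<zeta> D D' \<psi> \<phi> induced"
  unfolding induced_map_def linear_maps_h_lie
proof (intro conjI ballI induced_linear)
  fix \<alpha>
  have "lform D \<alpha> (inv_into UNIV \<psi> y) = lform D' (\<psi> \<alpha>) y" for y
    using lform_psi[of \<alpha> "inv_into UNIV \<psi> y"] bij_psi by (simp add: bij_def surj_f_inv_f)
  then show "induced (coroot \<zeta> D \<alpha>) = coroot \<zeta> D' (\<psi> \<alpha>)"
    by (simp add: dom.coroot_eq cod.coroot_eq induced_lcls push_simps)
next
  fix a assume "a \<in> ext_roots D"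
  then show "induced (X_elem \<zeta> D a) = X_elem \<zeta> D' (map_prod \<psi> \<phi> a)"
    by (simp add: dom.X_elem_eq cod.X_elem_eq induced_lcls push_simps)
qed

section \<open>Uniqueness, compatibility with the brackets and inverses\<close>

lemma induced_map_unique:
  assumes "induced_map \<zeta> D D' \<psi> \<phi> f" and "induced_map \<zeta> D D' \<psi> \<phi> g" and "x \<in> carrier (h_space \<zeta> D)"
  shows "f x = g x"
proof (rule dom.linear_maps_eq[OF cod.module_h_space _ _ _ _ assms(3)])
  show "f \<in> linear_maps (h_space \<zeta> D) (h_space \<zeta> D')" "g \<in> linear_maps (h_space \<zeta> D) (h_space \<zeta> D')"
    using assms(1,2) unfolding induced_map_def linear_maps_h_lie by blast+
qed (use assms(1,2) in \<open>simp_all add: induced_map_def\<close>)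

lemma induced_map_mult:
  assumes f: "induced_map \<zeta> D D' \<psi> \<phi> f"
    and x: "x \<in> carrier (h_space \<zeta> D)" and y: "y \<in> carrier (h_space \<zeta> D)"
  shows "f (x \<otimes>\<^bsub>h_lie \<zeta> D\<^esub> y) = f x \<otimes>\<^bsub>h_lie \<zeta> D'\<^esub> f y"
proof -
  have lin: "f \<in> linear_maps (h_space \<zeta> D) (h_space \<zeta> D')"
    and f_coroot: "\<And>\<alpha>. \<alpha> \<in> roots (lform D) \<Longrightarrow> f (coroot \<zeta> D \<alpha>) = coroot \<zeta> D' (\<psi> \<alpha>)"
    and f_X: "\<And>a. a \<in> ext_roots D \<Longrightarrow> f (X_elem \<zeta> D a) = X_elem \<zeta> D' (map_prod \<psi> \<phi> a)"
    using f unfolding induced_map_def linear_maps_h_lie by blast+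
  note fD = linear_mapsD[OF lin]
  note f_zero = linear_maps_zero[OF dom.module_h_space cod.module_h_space lin]
  \<comment> \<open>For fixed \<open>x\<close> both sides are linear in \<open>y\<close>, so
    \<open>y\<close> may be taken among the generators. The same argument in the first variable then
    leaves four kinds of pairs of generators.\<close>
  have left: "f (x \<otimes>\<^bsub>h_lie \<zeta> D\<^esub> y) = f x \<otimes>\<^bsub>h_lie \<zeta> D'\<^esub> f y"
    if x: "x \<in> carrier (h_space \<zeta> D)" and y: "y \<in> carrier (h_space \<zeta> D)"
      and coroot: "\<And>\<alpha>. \<alpha> \<in> roots (lform D) \<Longrightarrow>
        f (x \<otimes>\<^bsub>h_lie \<zeta> D\<^esub> coroot \<zeta> D \<alpha>) = f x \<otimes>\<^bsub>h_lie \<zeta> D'\<^esub> f (coroot \<zeta> D \<alpha>)"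
      and X_elem: "\<And>a. a \<in> ext_roots D \<Longrightarrow>
        f (x \<otimes>\<^bsub>h_lie \<zeta> D\<^esub> X_elem \<zeta> D a) = f x \<otimes>\<^bsub>h_lie \<zeta> D'\<^esub> f (X_elem \<zeta> D a)"
    for x y
    by (rule dom.linear_maps_eq[OF cod.module_h_space
          linear_maps_comp[OF dom.h_lie_mult_linear(1)[OF x] lin]
          linear_maps_comp[OF lin cod.h_lie_mult_linear(1)[OF fD(1)[OF x]]] coroot X_elem y])
  show ?thesis
  proof (rule dom.linear_maps_eq[OF cod.module_h_space
        linear_maps_comp[OF dom.h_lie_mult_linear(2)[OF y] lin]
        linear_maps_comp[OF lin cod.h_lie_mult_linear(2)[OF fD(1)[OF y]]] _ _ x])
    fix \<alpha> assume \<alpha>: "\<alpha> \<in> roots (lform D)"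
    show "f (coroot \<zeta> D \<alpha> \<otimes>\<^bsub>h_lie \<zeta> D\<^esub> y) = f (coroot \<zeta> D \<alpha>) \<otimes>\<^bsub>h_lie \<zeta> D'\<^esub> f y"
    proof (rule left[OF dom.coroot_closed y])
      fix \<beta> assume \<beta>: "\<beta> \<in> roots (lform D)"
      show "f (coroot \<zeta> D \<alpha> \<otimes>\<^bsub>h_lie \<zeta> D\<^esub> coroot \<zeta> D \<beta>)
          = f (coroot \<zeta> D \<alpha>) \<otimes>\<^bsub>h_lie \<zeta> D'\<^esub> f (coroot \<zeta> D \<beta>)"
        unfolding f_coroot[OF \<alpha>] f_coroot[OF \<beta>] dom.h_lie_mult_coroot_coroot cod.h_lie_mult_coroot_coroot
        by (rule f_zero)
    next
      fix b assume b: "b \<in> ext_roots D"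
      show "f (coroot \<zeta> D \<alpha> \<otimes>\<^bsub>h_lie \<zeta> D\<^esub> X_elem \<zeta> D b)
          = f (coroot \<zeta> D \<alpha>) \<otimes>\<^bsub>h_lie \<zeta> D'\<^esub> f (X_elem \<zeta> D b)"
        using \<alpha> b by (simp add: f_coroot f_X dom.h_lie_mult_coroot_X cod.h_lie_mult_coroot_X psi_roots
            map_prod_ext_roots fD dom.X_elem_closed lform_psi)
    qed
  next
    fix a assume a: "a \<in> ext_roots D"
    show "f (X_elem \<zeta> D a \<otimes>\<^bsub>h_lie \<zeta> D\<^esub> y) = f (X_elem \<zeta> D a) \<otimes>\<^bsub>h_lie \<zeta> D'\<^esub> f y"
    proof (rule left[OF dom.X_elem_closed[OF a] y])
      fix \<beta> assume \<beta>: "\<beta> \<in> roots (lform D)"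
      show "f (X_elem \<zeta> D a \<otimes>\<^bsub>h_lie \<zeta> D\<^esub> coroot \<zeta> D \<beta>)
          = f (X_elem \<zeta> D a) \<otimes>\<^bsub>h_lie \<zeta> D'\<^esub> f (coroot \<zeta> D \<beta>)"
        using \<beta> a by (simp add: f_coroot f_X dom.h_lie_mult_X_coroot cod.h_lie_mult_X_coroot psi_roots
            map_prod_ext_roots fD dom.X_elem_closed lform_psi)
    next
      fix b assume b: "b \<in> ext_roots D"
      \<comment> \<open>This and \<open>roots_iff\<close> ensure that the bracket of two root
        vectors falls into the same case before and after transport.\<close>
      have zero_iff: "\<psi> (fst a) + \<psi> (fst b) = 0 \<longleftrightarrow> fst a + fst b = 0"
        using bij_psi additive.add[OF additive_psi, of "fst a" "fst b"] additive.zero[OF additive_psi]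
        by (metis bij_def injD)
      have roots_iff: "\<psi> (fst a) + \<psi> (fst b) \<in> roots (lform D') \<longleftrightarrow> fst a + fst b \<in> roots (lform D)"
        using psi_roots[of "fst a + fst b"] by (simp add: additive.add[OF additive_psi])
      have mult: "map_prod \<psi> \<phi> a \<otimes>\<^bsub>lat_ext D'\<^esub> map_prod \<psi> \<phi> b = map_prod \<psi> \<phi> (a \<otimes>\<^bsub>lat_ext D\<^esub> b)"
        using a b by (simp add: map_prod_mult dom.ext_roots_carrier)
      have ab: "a \<otimes>\<^bsub>lat_ext D\<^esub> b \<in> carrier (lat_ext D)"
        using a b by (simp add: dom.ext_roots_carrier)
      consider "fst a + fst b = 0" | "fst a + fst b \<noteq> 0" "fst a + fst b \<in> roots (lform D)"
        | "fst a + fst b \<noteq> 0" "fst a + fst b \<notin> roots (lform D)" by blast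
      then show "f (X_elem \<zeta> D a \<otimes>\<^bsub>h_lie \<zeta> D\<^esub> X_elem \<zeta> D b)
          = f (X_elem \<zeta> D a) \<otimes>\<^bsub>h_lie \<zeta> D'\<^esub> f (X_elem \<zeta> D b)"
      proof cases
        case 1
        have "fst a \<in> roots (lform D)"
          using a by (simp add: ext_roots_def)
        then show ?thesis
          using a b 1 by (simp add: f_X f_coroot dom.h_lie_mult_X_X cod.h_lie_mult_X_X map_prod_ext_roots
              zero_iff mult central_scalar_map_prod[OF ab] eps_psi fD dom.coroot_closed)
      next
        case 2
        then have "a \<otimes>\<^bsub>lat_ext D\<^esub> b \<in> ext_roots D"
          using ab by (simp add: ext_roots_def)
        then show ?thesis
          using a b 2 by (simp add: f_X dom.h_lie_mult_X_X cod.h_lie_mult_X_X map_prod_ext_roots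
              zero_iff roots_iff mult eps_psi fD dom.X_elem_closed)
      next
        case 3
        then show ?thesis
          using a b by (simp add: f_X dom.h_lie_mult_X_X cod.h_lie_mult_X_X map_prod_ext_roots
              zero_iff roots_iff f_zero)
      qed
    qed
  qed
qed

end

text \<open>The composite fixes all coroots and all \<open>X_elem\<close>, so it agrees with the
  identity. The second pair of maps is arbitrary, subject to cancellation, so that the lemma covers
  both orders of composition.\<close>

lemma induced_map_left_inverse:
  fixes \<zeta> :: "'k::field_char_0"
  assumes "lie_datum_iso \<zeta> D D' \<psi> \<phi>"
    and f: "induced_map \<zeta> D D' \<psi> \<phi> f" and g: "induced_map \<zeta> D' D \<psi>' \<phi>' g"
    and \<psi>: "\<And>x. \<psi>' (\<psi> x) = x" and \<phi>: "\<And>h. h \<in> carrier (ext D) \<Longrightarrow> \<phi>' (\<phi> h) = h"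
    and x: "x \<in> carrier (h_space \<zeta> D)"
  shows "g (f x) = x"
proof -
  interpret lie_datum_iso \<zeta> D D' \<psi> \<phi> by fact
  have id: "(\<lambda>x. x) \<in> linear_maps (h_space \<zeta> D) (h_space \<zeta> D)"
    by (simp add: linear_maps_def)
  have lin: "f \<in> linear_maps (h_space \<zeta> D) (h_space \<zeta> D')" "g \<in> linear_maps (h_space \<zeta> D') (h_space \<zeta> D)"
    using f g unfolding induced_map_def linear_maps_h_lie by blast+
  show ?thesis
  proof (rule dom.linear_maps_eq[OF dom.module_h_space linear_maps_comp[OF lin] id _ _ x])
    show "g (f (coroot \<zeta> D \<alpha>)) = coroot \<zeta> D \<alpha>" if "\<alpha> \<in> roots (lform D)" for \<alpha>
      using that f g by (simp add: induced_map_def psi_roots \<psi>)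
    show "g (f (X_elem \<zeta> D a)) = X_elem \<zeta> D a" if "a \<in> ext_roots D" for a
    proof -
      have "snd a \<in> carrier (ext D)"
        using that by (simp add: ext_roots_def carrier_lat_ext_iff)
      then have "map_prod \<psi>' \<phi>' (map_prod \<psi> \<phi> a) = a"
        by (simp add: prod_eq_iff \<psi> \<phi>)
      then show ?thesis
        using that f g map_prod_ext_roots[OF that] by (simp add: induced_map_def)
    qed
  qed
qed

theorem lemma2p3:
  fixes \<zeta> :: "'k::field_char_0"
    and D :: "('l::ab_group_add, 'h, 'k) datum"
    and D' :: "('m::ab_group_add, 'g, 'k) datum"
    and \<psi> :: "'l \<Rightarrow> 'm" and \<phi> :: "'h \<Rightarrow> 'g"
  assumes "input_datum \<zeta> D" and "input_datum \<zeta> D'"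
    and "datum_iso \<zeta> D D' \<psi> \<phi>"
  shows "map_prod \<psi> \<phi> \<in> iso (lat_ext D) (lat_ext D') \<and>
    (\<exists>!f. f \<in> extensional (carrier (h_lie \<zeta> D)) \<and> induced_map \<zeta> D D' \<psi> \<phi> f) \<and>
    (\<forall>f. induced_map \<zeta> D D' \<psi> \<phi> f \<longrightarrow> f \<in> lie_iso (h_lie \<zeta> D) (h_lie \<zeta> D'))"
proof (intro conjI allI impI)
  interpret lie_datum_iso \<zeta> D D' \<psi> \<phi>
    using assms by unfold_locales
  let ?\<psi> = "inv_into UNIV \<psi>" and ?\<phi> = "inv_into (carrier (ext D)) \<phi>"
  interpret sym: lie_datum_iso \<zeta> D' D ?\<psi> ?\<phi>
    using datum_iso_sym by unfold_locales
  let ?H = "carrier (h_space \<zeta> D)"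
  show "map_prod \<psi> \<phi> \<in> iso (lat_ext D) (lat_ext D')"
    by (rule map_prod_iso)
  have "induced_map \<zeta> D D' \<psi> \<phi> (restrict induced ?H)"
  proof -
    \<comment> \<open>Restriction fixes the values outside the carrier, which the uniqueness of a
      total function requires. Linearity survives because the carrier is closed under sums and
      scalar multiples.\<close>
    have "restrict induced ?H \<in> linear_maps (h_space \<zeta> D) (h_space \<zeta> D')"
      using induced_linear module.smult_closed[OF dom.module_h_space]
        abelian_monoid.a_closed[OF abelian_group.axioms(1)[OF module.axioms(2)[OF dom.module_h_space]]]
      by (auto simp: linear_maps_def)
    then show ?thesis
      using induced_map_induced dom.coroot_closed dom.X_elem_closed
      by (simp add: induced_map_def linear_maps_h_lie)
  qed
  then show "\<exists>!f. f \<in> extensional (carrier (h_lie \<zeta> D)) \<and> induced_map \<zeta> D D' \<psi> \<phi> f"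
  proof (intro ex1I[of _ "restrict induced ?H"] conjI)
    fix g assume g: "g \<in> extensional (carrier (h_lie \<zeta> D)) \<and> induced_map \<zeta> D D' \<psi> \<phi> g"
    then show "g = restrict induced ?H"
      using induced_map_unique[OF _ induced_map_induced] by (auto intro: extensionalityI)
  qed auto
  fix f assume f: "induced_map \<zeta> D D' \<psi> \<phi> f"
  note g = sym.induced_map_induced
  have lin: "f \<in> linear_maps (h_space \<zeta> D) (h_space \<zeta> D')"
    using f by (simp add: induced_map_def linear_maps_h_lie)
  have "bij_betw f ?H (carrier (h_space \<zeta> D'))"
  proof (rule bij_betw_byWitness[where f' = sym.induced])
    show "\<forall>x\<in>?H. sym.induced (f x) = x"
      using induced_map_left_inverse[OF lie_datum_iso_axioms f g] bij_psi
        inv_into_f_f[OF bij_betw_imp_inj_on[OF bij_phi]]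
      by (simp add: bij_def)
    show "\<forall>y\<in>carrier (h_space \<zeta> D'). f (sym.induced y) = y"
      using induced_map_left_inverse[OF sym.lie_datum_iso_axioms g f] bij_psi
        f_inv_into_f[of _ \<phi> "carrier (ext D)"] bij_betw_imp_surj_on[OF bij_phi]
      by (simp add: bij_def surj_f_inv_f)
  qed (use linear_mapsD(1)[OF lin] linear_mapsD(1)[OF sym.induced_linear] in auto)
  then show "f \<in> lie_iso (h_lie \<zeta> D) (h_lie \<zeta> D')"
    using lin induced_map_mult[OF f] by (simp add: lie_iso_def linear_maps_h_lie)
qed

end
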